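(* Let $(X,S)$ be an asymmetric rank $3$ association scheme of order $n=4u+3$, $u\ge 0$, with adjacency matrices $I_n=A_0$, $A_1$, $A_1^{\top}$. Let $T_x$ be the complex Terwilliger algebra with respect to some $x\in X$, let $E_0^*,E_1^*,E_2^*$ be the dual idempotents with respect to $x$, and let $B_1$ be the $(2u+1)\times(2u+1)$ matrix obtained as the nonzero block of $E_1^*A_1E_1^*$ (the principal submatrix of $A_1$ indexed by the vertices $y$ with $(A_1)_{xy}=1$). Let $\alpha=\frac{-1+\sqrt{-n}}{2}$. Then: (i) Every non-primary irreducible $T_x$-module has dimension $1$ or $2$. (ii) The number of pairwise non-isomorphic $1$-dimensional irreducible $T_x$-modules is either $0$ or $4$, and it is $4$ exactly when $\alpha$ is an eigenvalue of $B_1$. (iii) Let $d_\alpha\ge 0$ be the dimension of the $\alpha$-eigenspace of $B_1$. Then the number $m_2$ of isomorphism classes of $2$-dimensional irreducible $T_x$-modules satisfies $0\le m_2\le 2(u-d_\alpha)$, and $\dim T_x=9+4\epsilon+4m_2$, where $\epsilon=1$ if $T_x$ has a $1$-dimensional irreducible module and $\epsilon=0$ otherwise.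
   Context: An asymmetric rank $3$ association scheme on $X=\{1,\dots,n\}$ has adjacency matrices $A_0=I_n$, $A_1$, $A_1^{\top}$ with $A_1\neq A_1^{\top}$ and $I_n+A_1+A_1^{\top}=J_n$ (all-ones); $A_1$ is the adjacency matrix of a doubly regular tournament. For $x\in X$, the dual idempotents $E_0^*,E_1^*,E_2^*$ are the diagonal $01$-matrices with $(E_i^* )_{yy}=1$ iff $(A_i)_{xy}=1$ (with $A_2=A_1^{\top}$). The Terwilliger algebra $T_x\subseteq M_n(\mathbb{C})$ is generated by the $A_i$ and $E_i^*$; it acts on the standard module $\mathbb{C}^n$. The primary module is $T_x\mathbf{e}$, where $\mathbf{e}$ is the all-ones vector of length $n$ (it is irreducible of dimension $3$). *)

theory Defs
  imports "HOL-Analysis.Analysis" "HOL-Library.Disjoint_Sets"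
begin

text \<open>The point set \<open>X\<close> is a finite type \<open>'n\<close>, and its order is \<open>CARD('n)\<close>.\<close>

definition association_scheme :: "('n::finite \<times> 'n) set set \<Rightarrow> bool" where
  "association_scheme S \<longleftrightarrow>
     partition_on UNIV S \<and> Id \<in> S \<and> (\<forall>s\<in>S. s\<inverse> \<in> S) \<and>
     (\<forall>r\<in>S. \<forall>s\<in>S. \<forall>t\<in>S. \<exists>p::nat. \<forall>(y, z)\<in>t. card {w. (y, w) \<in> r \<and> (w, z) \<in> s} = p)"

definition adjacency :: "('n::finite \<times> 'n) set \<Rightarrow> complex^'n^'n" where
  "adjacency s = (\<chi> y z. if (y, z) \<in> s then 1 else 0)"

definition dual_idempotent :: "'n::finite \<Rightarrow> ('n \<times> 'n) set \<Rightarrow> complex^'n^'n" where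
  "dual_idempotent x s = (\<chi> y z. if y = z \<and> (x, y) \<in> s then 1 else 0)"

text \<open>The library's \<open>*s\<close> on \<open>complex^'n^'n\<close> expects row-vector scalars and its \<open>*\<^sub>R\<close> is real, so
  the complex vector space of matrices gets its own scaling.\<close>

definition mscale :: "complex \<Rightarrow> complex^'n^'m \<Rightarrow> complex^'n^'m" where
  "mscale c M = (\<chi> i j. c * M $ i $ j)"

interpretation mat_vs: vector_space "mscale :: complex \<Rightarrow> complex^'n^'m \<Rightarrow> complex^'n^'m"
  by unfold_locales (simp_all add: mscale_def vec_eq_iff algebra_simps)

definition matrix_subalgebra :: "(complex^'n::finite^'n) set \<Rightarrow> bool" where
  "matrix_subalgebra T \<longleftrightarrow>
     module.subspace mscale T \<and> mat 1 \<in> T \<and> (\<forall>M\<in>T. \<forall>N\<in>T. M ** N \<in> T)"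

definition terwilliger_algebra :: "('n::finite \<times> 'n) set set \<Rightarrow> 'n \<Rightarrow> (complex^'n^'n) set" where
  "terwilliger_algebra S x = matrix_subalgebra hull (adjacency ` S \<union> dual_idempotent x ` S)"

text \<open>A \<open>T\<close>-module is abstract, not necessarily contained in the standard module: its underlying
  space is any subspace \<open>W\<close> of a complex vector space type \<open>'v\<close> with scaling \<open>smul\<close>, and \<open>act\<close> is
  any unital action of \<open>T\<close> on \<open>W\<close>. Only the values of \<open>act\<close> on \<open>T\<close> and \<open>W\<close> are relevant.\<close>

definition is_module ::
  "(complex^'n::finite^'n) set \<Rightarrow> (complex \<Rightarrow> 'v::ab_group_add \<Rightarrow> 'v) \<Rightarrow>
   'v set \<Rightarrow> (complex^'n^'n \<Rightarrow> 'v \<Rightarrow> 'v) \<Rightarrow> bool" where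
  "is_module T smul W act \<longleftrightarrow>
     module.subspace smul W \<and>
     (\<forall>M\<in>T. \<forall>w\<in>W. act M w \<in> W) \<and>
     (\<forall>M\<in>T. \<forall>v\<in>W. \<forall>w\<in>W. act M (v + w) = act M v + act M w) \<and>
     (\<forall>M\<in>T. \<forall>c. \<forall>w\<in>W. act M (smul c w) = smul c (act M w)) \<and>
     (\<forall>M\<in>T. \<forall>N\<in>T. \<forall>w\<in>W. act (M + N) w = act M w + act N w) \<and>
     (\<forall>c. \<forall>M\<in>T. \<forall>w\<in>W. act (mscale c M) w = smul c (act M w)) \<and>
     (\<forall>M\<in>T. \<forall>N\<in>T. \<forall>w\<in>W. act (M ** N) w = act M (act N w)) \<and>
     (\<forall>w\<in>W. act (mat 1) w = w)"

definition irreducible_module ::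
  "(complex^'n::finite^'n) set \<Rightarrow> (complex \<Rightarrow> 'v::ab_group_add \<Rightarrow> 'v) \<Rightarrow>
   'v set \<Rightarrow> (complex^'n^'n \<Rightarrow> 'v \<Rightarrow> 'v) \<Rightarrow> bool" where
  "irreducible_module T smul W act \<longleftrightarrow>
     is_module T smul W act \<and> W \<noteq> {0} \<and>
     (\<forall>U. module.subspace smul U \<and> U \<subseteq> W \<and> (\<forall>M\<in>T. \<forall>u\<in>U. act M u \<in> U)
        \<longrightarrow> U = {0} \<or> U = W)"

definition modules_isomorphic ::
  "(complex^'n::finite^'n) set \<Rightarrow>
   (complex \<Rightarrow> 'v::ab_group_add \<Rightarrow> 'v) \<Rightarrow> 'v set \<Rightarrow> (complex^'n^'n \<Rightarrow> 'v \<Rightarrow> 'v) \<Rightarrow>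
   (complex \<Rightarrow> 'w::ab_group_add \<Rightarrow> 'w) \<Rightarrow> 'w set \<Rightarrow> (complex^'n^'n \<Rightarrow> 'w \<Rightarrow> 'w) \<Rightarrow> bool" where
  "modules_isomorphic T smul W act smul' W' act' \<longleftrightarrow>
     (\<exists>f. bij_betw f W W' \<and>
          (\<forall>v\<in>W. \<forall>w\<in>W. f (v + w) = f v + f w) \<and>
          (\<forall>c. \<forall>w\<in>W. f (smul c w) = smul' c (f w)) \<and>
          (\<forall>M\<in>T. \<forall>w\<in>W. f (act M w) = act' M (f w)))"

text \<open>The subspace of the standard module generated by the all-ones vector; its action is \<open>*v\<close>.\<close>

definition primary_module :: "(complex^'n::finite^'n) set \<Rightarrow> (complex^'n) set" where
  "primary_module T = {M *v 1 | M. M \<in> T}"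

text \<open>Isomorphism classes need a set from which the underlying spaces are drawn. Subspaces of
  \<open>complex^'n\<close> (with an arbitrary action, unrelated to \<open>*v\<close>) suffice for dimensions
  \<open>d \<le> CARD('n)\<close>, since every complex vector space of dimension \<open>d\<close> is then
  linearly isomorphic to one of them.\<close>

definition irreducible_modules_dim ::
  "(complex^'n::finite^'n) set \<Rightarrow> nat \<Rightarrow>
   ((complex^'n) set \<times> (complex^'n^'n \<Rightarrow> complex^'n \<Rightarrow> complex^'n)) set" where
  "irreducible_modules_dim T d = {(W, act). irreducible_module T (*s) W act \<and> vec.dim W = d}"

definition iso_classes_dim ::
  "(complex^'n::finite^'n) set \<Rightarrow> nat \<Rightarrow>
   ((complex^'n) set \<times> (complex^'n^'n \<Rightarrow> complex^'n \<Rightarrow> complex^'n)) set set" where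
  "iso_classes_dim T d =
     irreducible_modules_dim T d //
       {((W, act), (W', act')).
          (W, act) \<in> irreducible_modules_dim T d \<and> (W', act') \<in> irreducible_modules_dim T d \<and>
          modules_isomorphic T (*s) W act (*s) W' act'}"

definition eigenspace :: "complex^'m^'m \<Rightarrow> complex \<Rightarrow> (complex^'m) set" where
  "eigenspace B a = {v. B *v v = a *s v}"

definition is_eigenvalue :: "complex^'m^'m \<Rightarrow> complex \<Rightarrow> bool" where
  "is_eigenvalue B a \<longleftrightarrow> (\<exists>v. v \<noteq> 0 \<and> B *v v = a *s v)"

text \<open>\<open>idx\<close> enumerates the points \<open>y\<close> with \<open>(x, y) \<in> R\<close> by the type \<open>'m\<close>, which therefore has
  exactly as many elements as there are such points; \<open>B\<close> is the corresponding block of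
  \<open>E\<^sub>1\<^sup>* A\<^sub>1 E\<^sub>1\<^sup>*\<close>.\<close>

definition is_local_block ::
  "('n::finite \<times> 'n) set \<Rightarrow> 'n \<Rightarrow> ('m::finite \<Rightarrow> 'n) \<Rightarrow> complex^'m^'m \<Rightarrow> bool" where
  "is_local_block R x idx B \<longleftrightarrow>
     bij_betw idx UNIV {y. (x, y) \<in> R} \<and>
     B = (\<chi> i j. (dual_idempotent x R ** adjacency R ** dual_idempotent x R)
                   $ idx i $ idx j)"

end

theory Submission
  imports Defs "HOL-Computational_Algebra.Fundamental_Theorem_Algebra"
begin

text \<open>Let \<open>A\<close> be the adjacency matrix of the tournament. The span of the indicator vectors of \<open>x\<close>, of its
  out-neighbourhood and of its in-neighbourhood is the primary module, and \<open>A\<close> commutes with the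
  projection onto its orthogonal complement. That complement is \<open>V\<^sub>1 \<oplus> V\<^sub>2\<close>, the vectors of zero sum
  supported on the out- and on the in-neighbourhood, each of dimension \<open>2u\<close>. There \<open>J = 0\<close>, so
  \<open>A\<^sup>T = - 1 - A\<close> and \<open>A\<^sup>2 + A + (u + 1) = (A - \<alpha>) (A - \<beta>) = 0\<close>, where \<open>\<beta>\<close> is the conjugate of \<open>\<alpha>\<close>. Writing \<open>A\<close>
  in blocks \<open>b, c, d, e\<close> with respect to \<open>V\<^sub>1 \<oplus> V\<^sub>2\<close>, the block \<open>b\<close> is normal and \<open>d\<close> maps its \<open>l\<close>-eigenspace
  to the \<open>(- 1 - l)\<close>-eigenspace of \<open>e\<close>, with \<open>c d = - (b - \<alpha>) (b - \<beta>)\<close>. Hence every eigenvalue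
  \<open>l \<notin> {\<alpha>, \<beta>}\<close> of \<open>b\<close> yields a full \<open>2 \<times> 2\<close> matrix block of the Terwilliger algebra, while on the remaining
  parts of \<open>V\<^sub>1\<close> and \<open>V\<^sub>2\<close> both \<open>c\<close> and \<open>d\<close> vanish and \<open>b\<close>, \<open>e\<close> have only the eigenvalues \<open>\<alpha>\<close>, \<open>\<beta>\<close>. Transposition
  exchanges \<open>\<alpha>\<close> and \<open>\<beta>\<close>, and \<open>dim V\<^sub>1 = dim V\<^sub>2\<close>, so the four multiplicities are equal. The
  matrix units of all these blocks span the algebra, which gives its dimension and its irreducible
  modules.\<close>

section \<open>Complex matrices\<close>

named_theorems matrix_algebra

lemma matrix_sum_ldistrib [matrix_algebra]: "(A :: complex^'n^'m) ** sum f I = (\<Sum>i\<in>I. A ** f i)"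
  by (induction I rule: infinite_finite_induct) (simp_all add: matrix_add_ldistrib)

lemma matrix_mult_add_left [matrix_algebra]: "((A :: complex^'n^'m) + B) ** C = A ** C + B ** C"
  by (vector matrix_matrix_mult_def sum.distrib[symmetric] field_simps)

lemma matrix_sum_rdistrib [matrix_algebra]: "sum f I ** (A :: complex^'n^'m) = (\<Sum>i\<in>I. f i ** A)"
  by (induction I rule: infinite_finite_induct) (simp_all add: matrix_mult_add_left)

lemma mscale_mult_left [matrix_algebra]: "mscale c A ** B = mscale c (A ** B)"
  by (simp add: mscale_def matrix_matrix_mult_def vec_eq_iff sum_distrib_left mult.assoc)

lemma mscale_mult_right [matrix_algebra]: "A ** mscale c B = mscale c (A ** B)"
  by (simp add: mscale_def matrix_matrix_mult_def vec_eq_iff sum_distrib_left mult_ac)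

lemma matrix_minus_ldistrib [matrix_algebra]: "(A :: complex^'n^'m) ** (- B) = - (A ** B)"
  by (simp add: matrix_matrix_mult_def vec_eq_iff sum_negf)

lemma matrix_minus_rdistrib [matrix_algebra]: "(- A :: complex^'n^'m) ** B = - (A ** B)"
  by (simp add: matrix_matrix_mult_def vec_eq_iff sum_negf)

lemma matrix_diff_ldistrib [matrix_algebra]: "(A :: complex^'n^'m) ** (B - C) = A ** B - A ** C"
  using matrix_add_ldistrib[of A B "- C"] by (simp add: matrix_minus_ldistrib)

lemma matrix_diff_rdistrib [matrix_algebra]: "((A :: complex^'n^'m) - B) ** C = A ** C - B ** C"
  using matrix_mult_add_left[of A "- B" C] by (simp add: matrix_minus_rdistrib)

lemmas [matrix_algebra] = matrix_add_ldistrib matrix_mul_assoc[symmetric]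

lemma matrix_mult_0 [simp]: "(A :: complex^'n^'m) ** 0 = 0" "0 ** (A :: complex^'n^'m) = 0"
  by (simp_all add: matrix_matrix_mult_def vec_eq_iff)

lemma mscale_one [simp]: "mscale 1 M = M"
  by (rule mat_vs.scale_one)

lemma mscale_mscale [simp]: "mscale a (mscale b M) = mscale (a * b) M"
  by (rule mat_vs.scale_scale)

lemmas mscale_simps [matrix_algebra] =
  mat_vs.scale_right_distrib mat_vs.scale_right_diff_distrib mat_vs.scale_sum_right

lemma matrix_mult_eq_assoc: "A ** B = C \<Longrightarrow> A ** (B ** X) = C ** (X :: complex^'n^'m)"
  by (simp add: matrix_mul_assoc)

lemma matrix_mult_zero_right: "M ** N = 0 \<Longrightarrow> N ** X = X \<Longrightarrow> M ** X = 0"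
  and matrix_mult_zero_left: "N ** M = 0 \<Longrightarrow> X ** N = X \<Longrightarrow> X ** M = 0"
  for M N X :: "complex^'n^'n"
  by (metis matrix_mul_assoc matrix_mult_0)+

lemma matrix_mult_nth: "(M ** N) $ y $ z = (\<Sum>w\<in>UNIV. M $ y $ w * N $ w $ z)" for M N :: "complex^'n^'n"
  by (simp add: matrix_matrix_mult_def)

lemma mscale_vector_mult: "mscale c M *v v = c *s (M *v v)"
  by (simp add: mscale_def matrix_vector_mult_def vec_eq_iff sum_distrib_left mult.assoc)

lemma transpose_add: "transpose (A + B) = transpose A + transpose B"
  and transpose_mscale: "transpose (mscale c M) = mscale c (transpose M)"
  by (simp_all add: transpose_def mscale_def vec_eq_iff)

section \<open>Conjugate transposes and normal matrices\<close>

definition adjoint_matrix :: "complex^'n^'m \<Rightarrow> complex^'m^'n" where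
  "adjoint_matrix M = (\<chi> i j. cnj (M $ j $ i))"

lemma adjoint_matrix_mult: "adjoint_matrix (A ** B) = adjoint_matrix B ** adjoint_matrix A"
  by (simp add: adjoint_matrix_def matrix_matrix_mult_def vec_eq_iff mult.commute)

lemma adjoint_matrix_involutive [simp]: "adjoint_matrix (adjoint_matrix A) = A"
  by (simp add: adjoint_matrix_def vec_eq_iff)

lemma adjoint_matrix_minus: "adjoint_matrix (- A) = - adjoint_matrix A"
  by (simp add: adjoint_matrix_def vec_eq_iff)

lemma adjoint_matrix_diff: "adjoint_matrix (A - B) = adjoint_matrix A - adjoint_matrix B"
  by (simp add: adjoint_matrix_def vec_eq_iff)

lemma adjoint_matrix_mscale: "adjoint_matrix (mscale c A) = mscale (cnj c) (adjoint_matrix A)"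
  by (simp add: adjoint_matrix_def mscale_def vec_eq_iff)

lemma adjoint_matrix_mat_1 [simp]: "adjoint_matrix (mat 1) = mat 1"
  by (simp add: adjoint_matrix_def mat_def vec_eq_iff)

lemma adjoint_matrix_0 [simp]: "adjoint_matrix 0 = 0"
  by (simp add: adjoint_matrix_def vec_eq_iff)

text \<open>The \<open>j\<close>-th diagonal entry of \<open>adjoint_matrix M ** M\<close> is the
  sum of the squared moduli in column \<open>j\<close>. This positivity later forces
  \<open>F1 ** P 0\<close> and \<open>d ** P l\<close> to vanish.\<close>

lemma adjoint_mult_eq_0_iff:
  fixes M :: "complex^'n^'m"
  shows "adjoint_matrix M ** M = 0 \<longleftrightarrow> M = 0"
proof
  assume *: "adjoint_matrix M ** M = 0"
  have "M $ i $ j = 0" for i j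
  proof -
    have "(\<Sum>k\<in>UNIV. cnj (M $ k $ j) * M $ k $ j) = 0"
      using * by (simp add: adjoint_matrix_def matrix_matrix_mult_def vec_eq_iff)
    then have "(\<Sum>k\<in>UNIV. complex_of_real ((cmod (M $ k $ j))\<^sup>2)) = 0"
      by (simp only: complex_norm_square mult.commute)
    then have "(\<Sum>k\<in>UNIV. (cmod (M $ k $ j))\<^sup>2) = 0"
      by (metis of_real_eq_0_iff of_real_sum)
    then show ?thesis
      by (subst (asm) sum_nonneg_eq_0_iff) auto
  qed
  then show "M = 0"
    by (simp add: vec_eq_iff)
qed (simp add: matrix_matrix_mult_def vec_eq_iff)

text \<open>Put \<open>H = adjoint_matrix N ** N\<close>. Normality rewrites
  \<open>H ** (H ** X)\<close> so that it ends in \<open>N ** (N ** X)\<close>, hence it is 0;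
  positivity, applied first to \<open>H ** X\<close> and then to \<open>N ** X\<close>, removes one
  factor at a time.\<close>

lemma normal_square_kernel:
  assumes normal: "N ** adjoint_matrix N = adjoint_matrix N ** N"
    and "N ** (N ** X) = 0"
  shows "N ** X = 0"
proof -
  define H where "H = adjoint_matrix N ** N"
  have "adjoint_matrix (H ** X) ** (H ** X) = adjoint_matrix X ** (H ** (H ** X))"
    by (simp add: H_def adjoint_matrix_mult matrix_mul_assoc)
  also have "H ** (H ** X) = adjoint_matrix N ** (adjoint_matrix N ** (N ** (N ** X)))"
    unfolding H_def by (metis matrix_mul_assoc normal)
  finally have "H ** X = 0"
    by (simp add: assms adjoint_mult_eq_0_iff)
  moreover have "adjoint_matrix (N ** X) ** (N ** X) = adjoint_matrix X ** (H ** X)"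
    by (simp add: H_def adjoint_matrix_mult matrix_mul_assoc)
  ultimately show ?thesis
    by (simp add: adjoint_mult_eq_0_iff)
qed

section \<open>Spectral decomposition of a normal matrix\<close>

definition matrix_poly :: "complex^'n^'n \<Rightarrow> complex poly \<Rightarrow> complex^'n^'n" where
  "matrix_poly M p = fold_coeffs (\<lambda>a X. mscale a (mat 1) + M ** X) p 0"

lemma matrix_poly_0 [simp]: "matrix_poly M 0 = 0"
  by (simp add: matrix_poly_def)

lemma matrix_poly_pCons: "matrix_poly M (pCons a p) = mscale a (mat 1) + M ** matrix_poly M p"
  by (cases "p = 0 \<and> a = 0") (auto simp: matrix_poly_def)

lemma matrix_poly_1 [simp]: "matrix_poly M 1 = mat 1"
  by (simp add: one_pCons matrix_poly_pCons)

lemma matrix_poly_add: "matrix_poly M (p + q) = matrix_poly M p + matrix_poly M q"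
  by (induction p q rule: poly_induct2)
    (simp_all add: matrix_poly_pCons matrix_algebra mat_vs.scale_left_distrib)

lemma matrix_poly_smult: "matrix_poly M (smult c p) = mscale c (matrix_poly M p)"
  by (induction p) (simp_all add: matrix_poly_pCons matrix_algebra)

lemma matrix_poly_sum: "matrix_poly M (sum f I) = (\<Sum>i\<in>I. matrix_poly M (f i))"
  by (induction I rule: infinite_finite_induct) (simp_all add: matrix_poly_add)

lemma matrix_poly_mult: "matrix_poly M (p * q) = matrix_poly M p ** matrix_poly M q"
  by (induction p) (simp_all add: matrix_poly_pCons matrix_poly_add matrix_poly_smult matrix_algebra)

lemma matrix_poly_linear: "matrix_poly M [:- c, 1:] = M - mscale c (mat 1)"
  by (simp add: matrix_poly_pCons)

lemma finite_matrix_basis: "\<exists>B :: (complex^'n^'m) set. finite B \<and> mat_vs.span B = UNIV"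
proof -
  define E :: "'m \<times> 'n \<Rightarrow> complex^'n^'m" where
    "E p = (\<chi> k l. if (k, l) = p then 1 else 0)" for p
  have "M \<in> mat_vs.span (range E)" for M
  proof -
    have "M = (\<Sum>p\<in>UNIV. mscale (M $ fst p $ snd p) (E p))"
      by (simp add: vec_eq_iff E_def mscale_def if_distrib cong: if_cong del: Pair_inject)
    then show ?thesis
      by (metis (no_types, lifting) mat_vs.span_base mat_vs.span_scale mat_vs.span_sum rangeI)
  qed
  then show ?thesis
    by (intro exI[of _ "range E"]) auto
qed

text \<open>The powers of \<open>M\<close> lie in a finite-dimensional space. Linear dependence
  speaks of the set of powers, so a coincidence between two powers is a separate case.\<close>

lemma matrix_annihilating_poly:
  fixes M :: "complex^'n^'n"
  shows "\<exists>p. p \<noteq> 0 \<and> matrix_poly M p = 0"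
proof (cases "inj (\<lambda>i. matrix_poly M (monom 1 i))")
  case False
  then obtain i j where ij: "i \<noteq> j" "matrix_poly M (monom 1 i) = matrix_poly M (monom 1 j)"
    by (auto simp: inj_def)
  have "matrix_poly M (monom 1 i + smult (-1) (monom 1 j)) = 0"
    unfolding matrix_poly_add matrix_poly_smult ij by simp
  moreover have "coeff (monom 1 i + smult (-1) (monom 1 j) :: complex poly) i \<noteq> 0"
    using ij by simp
  ultimately show ?thesis
    by (metis coeff_0)
next
  case True
  let ?f = "\<lambda>i. matrix_poly M (monom 1 i)"
  obtain B :: "(complex^'n^'n) set" where B: "finite B" "mat_vs.span B = UNIV"
    using finite_matrix_basis by blast
  have "infinite (range ?f)"
    using True range_inj_infinite by blast
  then have "mat_vs.dependent (range ?f)"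
    using mat_vs.independent_span_bound[OF B(1), of "range ?f"] B(2) by auto
  then obtain V a v where V: "finite V" "V \<subseteq> range ?f" "(\<Sum>w\<in>V. mscale (a w) w) = 0"
    "v \<in> V" "a v \<noteq> 0"
    by (auto simp: mat_vs.dependent_explicit)
  \<comment> \<open>\<open>g\<close> reads off the exponent of a power, which turns the relation
    between matrices into a polynomial.\<close>
  define g where "g = inv ?f"
  have fg: "?f (g w) = w" if "w \<in> V" for w
    unfolding g_def using that V(2) by (metis f_inv_into_f subset_iff)
  define p where "p = (\<Sum>w\<in>V. smult (a w) (monom 1 (g w)))"
  have "matrix_poly M p = (\<Sum>w\<in>V. mscale (a w) w)"
    by (simp add: p_def matrix_poly_sum matrix_poly_smult fg del: smult_monom)
  moreover have "coeff p (g v) = (\<Sum>w\<in>V. if w = v then a w else 0)"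
    unfolding p_def coeff_sum
    by (intro sum.cong) (auto, metis V(4) fg)
  ultimately show ?thesis
    using V by (intro exI[of _ p]) auto
qed

lemma matrix_subalgebra_mat_1: "matrix_subalgebra T \<Longrightarrow> mat 1 \<in> T"
  by (simp add: matrix_subalgebra_def)

lemma matrix_subalgebra_mult: "matrix_subalgebra T \<Longrightarrow> M \<in> T \<Longrightarrow> N \<in> T \<Longrightarrow> M ** N \<in> T"
  by (simp add: matrix_subalgebra_def)

lemma matrix_subalgebra_subspace: "matrix_subalgebra T \<Longrightarrow> mat_vs.subspace T"
  by (simp add: matrix_subalgebra_def)

lemmas matrix_subalgebra_closed =
  matrix_subalgebra_mat_1 matrix_subalgebra_mult
  mat_vs.subspace_add[OF matrix_subalgebra_subspace]
  mat_vs.subspace_diff[OF matrix_subalgebra_subspace]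
  mat_vs.subspace_scale[OF matrix_subalgebra_subspace]
  mat_vs.subspace_0[OF matrix_subalgebra_subspace]

lemma matrix_subalgebra_poly:
  "matrix_subalgebra T \<Longrightarrow> M \<in> T \<Longrightarrow> matrix_poly M p \<in> T"
  by (induction p) (simp_all add: matrix_poly_pCons matrix_subalgebra_closed)

text \<open>\<open>P l\<close> is the Lagrange polynomial of the root \<open>l\<close> of the
  minimal polynomial, evaluated at \<open>M\<close>; hence it lies in every subalgebra containing
  \<open>M\<close>. Setting \<open>P l = 0\<close> off the spectrum lets the laws hold for all
  \<open>l\<close>.\<close>

lemma normal_matrix_spectral:
  fixes M :: "complex^'n^'n"
  assumes normal: "M ** adjoint_matrix M = adjoint_matrix M ** M"
  obtains \<Lambda> P where "finite \<Lambda>"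
    and "\<And>l. l \<in> \<Lambda> \<longleftrightarrow> P l \<noteq> 0"
    and "\<And>l. M ** P l = mscale l (P l)" "\<And>l. P l ** M = mscale l (P l)"
    and "\<And>l m. P l ** P m = (if l = m then P l else 0)"
    and "(\<Sum>l\<in>\<Lambda>. P l) = mat 1"
    and "\<And>T l. matrix_subalgebra T \<Longrightarrow> M \<in> T \<Longrightarrow> P l \<in> T"
proof -
  define p where "p = (ARG_MIN degree p. p \<noteq> 0 \<and> matrix_poly M p = 0)"
  have p: "p \<noteq> 0" "matrix_poly M p = 0"
    using arg_min_natI[of "\<lambda>p. p \<noteq> 0 \<and> matrix_poly M p = 0" _ degree]
      matrix_annihilating_poly[of M] unfolding p_def by blast+
  have p_min: "degree p \<le> degree q" if "q \<noteq> 0" "matrix_poly M q = 0" for q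
    using arg_min_nat_le[of "\<lambda>p. p \<noteq> 0 \<and> matrix_poly M p = 0" _ degree] that
    unfolding p_def by blast
  define \<Lambda> where "\<Lambda> = {z. poly p z = 0}"
  have fin: "finite \<Lambda>"
    unfolding \<Lambda>_def by (rule poly_roots_finite[OF p(1)])
  define c where "c l = (\<Prod>m\<in>\<Lambda>-{l}. l - m)" for l
  define L where "L l = smult (inverse (c l)) (\<Prod>m\<in>\<Lambda>-{l}. [:-m, 1:])" for l
  have c_nz: "c l \<noteq> 0" for l
    using fin by (auto simp: c_def)
  \<comment> \<open>At a double root \<open>normal_square_kernel\<close> would cancel one of the two
    factors and leave an annihilating polynomial of smaller degree.\<close>
  have "\<not> [:-l, 1:] ^ 2 dvd p" for l
  proof
    assume "[:-l, 1:] ^ 2 dvd p"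
    then obtain q where "p = [:-l, 1:] ^ 2 * q"
      by (rule dvdE)
    then have q: "p = [:-l, 1:] * ([:-l, 1:] * q)"
      by (simp only: power2_eq_square mult.assoc)
    define N where "N = M - mscale l (mat 1)"
    have "N ** adjoint_matrix N = adjoint_matrix N ** N"
      by (simp add: N_def adjoint_matrix_diff adjoint_matrix_mscale matrix_algebra normal)
    moreover have "N ** (N ** matrix_poly M q) = 0"
      using p(2) unfolding q by (simp only: matrix_poly_mult matrix_poly_linear N_def)
    ultimately have "matrix_poly M ([:-l, 1:] * q) = 0"
      unfolding matrix_poly_mult matrix_poly_linear N_def by (rule normal_square_kernel)
    moreover have "[:-l, 1:] * q \<noteq> 0" "degree ([:-l, 1:] * q) < degree p"
      using p(1) unfolding q by (auto simp: degree_mult_eq simp del: mult_pCons_left)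
    ultimately show False
      by (meson p_min leD)
  qed
  then have "rsquarefree p"
    using p(1) unfolding order_divides rsquarefree_def
    by (metis One_nat_def less_2_cases not_le)
  then have decomp: "smult (lead_coeff p) (\<Prod>z\<in>\<Lambda>. [:-z, 1:]) = p"
    unfolding \<Lambda>_def by (rule complex_poly_decompose_rsquarefree)
  have prod0: "matrix_poly M (\<Prod>z\<in>\<Lambda>. [:-z, 1:]) = 0"
    using p decomp matrix_poly_smult[of M "lead_coeff p" "\<Prod>z\<in>\<Lambda>. [:-z, 1:]"] by simp
  have root: "matrix_poly M ([:-l, 1:] * L l) = 0" if "l \<in> \<Lambda>" for l
  proof -
    have "[:-l, 1:] * L l = smult (inverse (c l)) (\<Prod>z\<in>\<Lambda>. [:-z, 1:])"
      unfolding L_def using that fin by (subst (2) prod.remove[of _ l]) (auto simp: mult_ac)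
    then show ?thesis
      by (simp only: matrix_poly_smult prod0 mat_vs.scale_zero_right)
  qed
  have deg_prod: "degree (\<Prod>z\<in>X. [:-z, 1:]) = card X" for X :: "complex set"
    by (subst degree_prod_sum_eq) auto
  define P where "P l = (if l \<in> \<Lambda> then matrix_poly M (L l) else 0)" for l
  have P_nz: "l \<in> \<Lambda> \<longleftrightarrow> P l \<noteq> 0" for l
  proof
    assume l: "l \<in> \<Lambda>"
    have "L l \<noteq> 0"
      using c_nz fin by (auto simp: L_def)
    moreover have "degree (L l) < degree p"
    proof -
      have "degree (L l) = card (\<Lambda> - {l})"
        using c_nz by (simp add: L_def deg_prod)
      also have "\<dots> < card \<Lambda>"
        by (rule psubset_card_mono[OF fin]) (use l in auto)
      also have "card \<Lambda> = degree p"
        using p(1) by (subst decomp[symmetric]) (simp add: deg_prod)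
      finally show ?thesis .
    qed
    ultimately show "P l \<noteq> 0"
      using p_min[of "L l"] l by (auto simp: P_def)
  qed (auto simp: P_def split: if_splits)
  have M_P: "M ** P l = mscale l (P l)" for l
    using root[of l, unfolded matrix_poly_mult matrix_poly_linear]
    by (cases "l \<in> \<Lambda>") (simp_all add: P_def matrix_algebra)
  have P_M: "P l ** M = mscale l (P l)" for l
    using root[of l, unfolded mult.commute[of "[:-l, 1:]"] matrix_poly_mult matrix_poly_linear]
    by (cases "l \<in> \<Lambda>") (simp_all add: P_def matrix_algebra)
  have orth: "P l ** P m = 0" if "l \<noteq> m" for l m
  proof -
    have "mscale m (P l ** P m) = P l ** (M ** P m)"
      by (simp add: M_P mscale_mult_right)
    also have "\<dots> = mscale l (P l ** P m)"
      by (simp add: matrix_mul_assoc P_M mscale_mult_left)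
    finally show ?thesis
      using that by simp
  qed
  \<comment> \<open>The difference of the two sides vanishes on \<open>\<Lambda>\<close> and has
    degree below \<open>card \<Lambda>\<close>.\<close>
  have "(\<Sum>l\<in>\<Lambda>. L l) = 1"
  proof (rule ccontr)
    define q where "q = (\<Sum>l\<in>\<Lambda>. L l) - 1"
    assume "\<not> ?thesis"
    then have q: "q \<noteq> 0"
      by (simp add: q_def)
    have L_eval: "poly (L l) m = (if m = l then 1 else 0)" if "m \<in> \<Lambda>" for l m
      using that fin c_nz by (auto simp: L_def poly_prod c_def)
    have "\<Lambda> \<subseteq> {z. poly q z = 0}"
      using fin by (auto simp: q_def poly_sum L_eval)
    then have "card \<Lambda> \<le> card {z. poly q z = 0}"
      by (intro card_mono poly_roots_finite q)
    also have "\<dots> \<le> degree q"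
      by (rule card_poly_roots_bound[OF q])
    finally have "card \<Lambda> \<le> degree q" .
    \<comment> \<open>If \<open>\<Lambda>\<close> were empty, the truncated bound
      \<open>card \<Lambda> - 1\<close> would not contradict the other one. But then the empty
      product would give \<open>mat 1 = 0\<close>.\<close>
    moreover have "(mat 1 :: complex^'n^'n) $ undefined $ undefined \<noteq> 0"
      by (simp add: mat_def)
    then have "\<Lambda> \<noteq> {}"
      using prod0 by auto
    then have "0 < card \<Lambda>"
      using fin by (simp add: card_gt_0_iff)
    moreover have "degree (L l) \<le> card \<Lambda> - 1" if "l \<in> \<Lambda>" for l
      using that fin c_nz by (simp add: L_def deg_prod)
    then have "degree q \<le> card \<Lambda> - 1"
      unfolding q_def by (intro degree_diff_le degree_sum_le fin) auto
    ultimately show False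
      by linarith
  qed
  then have sum1: "(\<Sum>l\<in>\<Lambda>. P l) = mat 1"
    by (simp add: P_def flip: matrix_poly_sum)
  have idem: "P l ** P l = P l" for l
  proof (cases "l \<in> \<Lambda>")
    case True
    have "P l = P l ** (\<Sum>m\<in>\<Lambda>. P m)"
      by (simp add: sum1)
    also have "\<dots> = (\<Sum>m\<in>\<Lambda>. if m = l then P l ** P l else 0)"
      unfolding matrix_sum_ldistrib by (intro sum.cong) (auto simp: orth)
    finally show ?thesis
      using True fin by simp
  qed (simp add: P_def)
  show ?thesis
  proof
    show "P l \<in> T" if "matrix_subalgebra T" "M \<in> T" for T l
      using that by (simp add: P_def matrix_subalgebra_poly matrix_subalgebra_closed)
  qed (use fin P_nz M_P P_M orth idem sum1 in auto)
qed

text \<open>Take a basis \<open>B\<close> of the range, on which \<open>P\<close> is the identity.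
  In the coordinates \<open>r v b\<close> of \<open>P *v v\<close> the trace becomes the sum over
  \<open>B\<close> of \<open>r b b = 1\<close>.\<close>

lemma trace_idempotent:
  fixes P :: "complex^'n^'n"
  assumes "P ** P = P"
  shows "trace P = of_nat (vec.dim (range ((*v) P)))"
proof -
  let ?V = "range ((*v) P)"
  obtain B where B: "B \<subseteq> ?V" "vec.independent B" "?V \<subseteq> vec.span B" "card B = vec.dim ?V"
    using vec.basis_exists by blast
  have finB: "finite B"
    using B(2) by (rule vec.finiteI_independent)
  define r where "r v = vec.representation B (P *v v)" for v
  have in_span: "P *v v \<in> vec.span B" for v
    using B(3) by auto
  have P_v: "P *v v = (\<Sum>b\<in>B. r v b *s b)" for v
    unfolding r_def by (rule vec.sum_representation_eq[OF B(2) in_span finB, symmetric]) simp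
  have r_sum: "r (\<Sum>i\<in>I. a i *s v i) b = (\<Sum>i\<in>I. a i * r (v i) b)" for I :: "'n set" and a v b
  proof -
    have "P *v (\<Sum>i\<in>I. a i *s v i) = (\<Sum>i\<in>I. a i *s (P *v v i))"
      by (simp add: vec.linear_sum matrix_vector_mult_scaleR vec.scale)
    then show ?thesis
      using in_span B(2)
      by (simp add: r_def vec.representation_sum vec.span_scale vec.representation_scale)
  qed
  have r_b: "r b b = 1" if "b \<in> B" for b
  proof -
    have "P *v b = b"
      using that B(1) assms by (auto simp: matrix_vector_mul_assoc)
    then show ?thesis
      using that B(2) by (simp add: r_def vec.representation_basis)
  qed
  have "trace P = (\<Sum>i\<in>UNIV. (P *v axis i 1) $ i)"
    by (simp add: trace_def matrix_vector_mult_def axis_def if_distrib cong: if_cong)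
  also have "\<dots> = (\<Sum>i\<in>UNIV. \<Sum>b\<in>B. r (axis i 1) b * b $ i)"
    by (simp add: P_v sum_component)
  also have "\<dots> = (\<Sum>b\<in>B. \<Sum>i\<in>UNIV. b $ i * r (axis i 1) b)"
    by (subst sum.swap) (simp add: mult.commute)
  also have "\<dots> = (\<Sum>b\<in>B. r (\<Sum>i\<in>UNIV. b $ i *s axis i 1) b)"
    by (simp add: r_sum)
  also have "\<dots> = of_nat (card B)"
    by (simp add: basis_expansion r_b)
  finally show ?thesis
    by (simp add: B(4))
qed

text \<open>The trace of an idempotent is its rank.\<close>

lemma idempotent_eq_0_iff: "X ** X = X \<Longrightarrow> X = 0 \<longleftrightarrow> trace X = (0 :: complex)" for X :: "complex^'n^'n"
  by (auto simp: trace_idempotent matrix_eq image_subset_iff)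

lemma trace_mscale: "trace (mscale s M) = s * trace M"
  by (simp add: trace_def mscale_def sum_distrib_left)

lemma trace_sum: "trace (sum f X :: complex^'n^'n) = (\<Sum>i\<in>X. trace (f i))"
  unfolding trace_def by (simp add: sum.swap[of _ UNIV])

lemma trace_transpose: "trace (transpose M) = trace M"
  by (simp add: trace_def transpose_def)

section \<open>Algebras spanned by matrix units and their modules\<close>

text \<open>Both modules are quotients of \<open>T\<close> by the annihilator of a generator. Equal
  annihilators make the map from \<open>act M w\<close> to \<open>act' M w'\<close> well defined and
  injective.\<close>

lemma cyclic_modules_isomorphic:
  assumes subalg: "matrix_subalgebra T"
    and mod: "is_module T smul W act" "is_module T smul' W' act'"
    and w: "w \<in> W" "w' \<in> W'"
    and cyc: "W = {act M w | M. M \<in> T}" "W' = {act' M w' | M. M \<in> T}"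
    and ann: "\<And>M. M \<in> T \<Longrightarrow> act M w = 0 \<longleftrightarrow> act' M w' = 0"
  shows "modules_isomorphic T smul W act smul' W' act'"
proof -
  note closed = matrix_subalgebra_closed[OF subalg]
  have lin: "act (M + N) w = act M w + act N w" "act' (M + N) w' = act' M w' + act' N w'"
    "act (mscale c M) w = smul c (act M w)" "act' (mscale c M) w' = smul' c (act' M w')"
    "act (M ** N) w = act M (act N w)" "act' (M ** N) w' = act' M (act' N w')"
    if "M \<in> T" "N \<in> T" for M N c
    using that mod w unfolding is_module_def by auto
  have diff: "act (M - N) w = act M w - act N w" "act' (M - N) w' = act' M w' - act' N w'"
    if "M \<in> T" "N \<in> T" for M N
    using lin(1,2)[of "M - N" N] that closed by simp_all
  have eq_iff: "act M w = act N w \<longleftrightarrow> act' M w' = act' N w'" if "M \<in> T" "N \<in> T" for M N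
    using ann[of "M - N"] diff[OF that] that closed by auto
  define f where "f v = act' (SOME M. M \<in> T \<and> act M w = v) w'" for v
  have f: "f (act M w) = act' M w'" if "M \<in> T" for M
  proof -
    have "(SOME N. N \<in> T \<and> act N w = act M w) \<in> T \<and> act (SOME N. N \<in> T \<and> act N w = act M w) w = act M w"
      using that by (intro someI_ex[of "\<lambda>N. N \<in> T \<and> act N w = act M w"]) auto
    then show ?thesis
      unfolding f_def using eq_iff that by blast
  qed
  have "bij_betw f W W'"
  proof (rule bij_betwI')
    show "f v = f z \<longleftrightarrow> v = z" if "v \<in> W" "z \<in> W" for v z
      using that eq_iff by (auto simp: cyc(1) f)
    show "f v \<in> W'" if "v \<in> W" for v
      using that by (auto simp: cyc f)
    show "\<exists>v\<in>W. y = f v" if "y \<in> W'" for y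
      using that by (auto simp: cyc) (metis f)
  qed
  moreover have "f (v + z) = f v + f z" if "v \<in> W" "z \<in> W" for v z
    using that closed by (auto simp: cyc f lin simp flip: lin(1))
  moreover have "f (smul c v) = smul' c (f v)" if "v \<in> W" for c v
    using that closed by (auto simp: cyc f lin simp flip: lin(3))
  moreover have "f (act M v) = act' M (f v)" if "M \<in> T" "v \<in> W" for M v
    using that closed by (auto simp: cyc f lin simp flip: lin(5))
  ultimately show ?thesis
    unfolding modules_isomorphic_def by blast
qed

text \<open>The classes are the nonempty fibres of \<open>f\<close>. Later \<open>f\<close> sends a
  module to its block, and isomorphism means equality of blocks.\<close>

lemma card_quotient_fibres:
  "card (A // {(a, b). a \<in> A \<and> b \<in> A \<and> f a = f b}) = card (f ` A)"
  and finite_quotient_fibres: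
  "finite (f ` A) \<Longrightarrow> finite (A // {(a, b). a \<in> A \<and> b \<in> A \<and> f a = f b})"
proof -
  have "bij_betw (\<lambda>y. {a \<in> A. y = f a}) (f ` A) (A // {(a, b). a \<in> A \<and> b \<in> A \<and> f a = f b})"
  proof (rule bij_betw_imageI)
    show "inj_on (\<lambda>y. {a \<in> A. y = f a}) (f ` A)"
      by (auto simp: inj_on_def)
    show "(\<lambda>y. {a \<in> A. y = f a}) ` f ` A = A // {(a, b). a \<in> A \<and> b \<in> A \<and> f a = f b}"
      by (auto simp: quotient_def image_iff Image_def)
  qed
  then show "card (A // {(a, b). a \<in> A \<and> b \<in> A \<and> f a = f b}) = card (f ` A)"
    "finite (f ` A) \<Longrightarrow> finite (A // {(a, b). a \<in> A \<and> b \<in> A \<and> f a = f b})"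
    by (auto simp: bij_betw_same_card[symmetric] bij_betw_finite)
qed

text \<open>The pattern of a direct sum of full matrix algebras of sizes \<open>sz b\<close>.
  Nonvanishing of \<open>e b 0 0\<close> spreads over its block, since
  \<open>e b 0 i ** e b i j ** e b j 0 = e b 0 0\<close>.\<close>

locale matrix_units =
  fixes I :: "'b set" and sz :: "'b \<Rightarrow> nat" and e :: "'b \<Rightarrow> nat \<Rightarrow> nat \<Rightarrow> complex^'n::finite^'n"
  assumes finite_blocks: "finite I"
    and sz_pos: "b \<in> I \<Longrightarrow> 0 < sz b"
    and e_mult: "\<lbrakk>b \<in> I; c \<in> I; i < sz b; j < sz b; k < sz c; l < sz c\<rbrakk>
      \<Longrightarrow> e b i j ** e c k l = (if b = c \<and> j = k then e b i l else 0)"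
    and e_nonzero: "b \<in> I \<Longrightarrow> e b 0 0 \<noteq> 0"
    and e_sum: "(\<Sum>b\<in>I. \<Sum>i<sz b. e b i i) = mat 1"
begin

definition units :: "(complex^'n^'n) set" where
  "units = {e b i j | b i j. b \<in> I \<and> i < sz b \<and> j < sz b}"

definition alg :: "(complex^'n^'n) set" where
  "alg = mat_vs.span units"

lemma e_in_alg: "\<lbrakk>b \<in> I; i < sz b; j < sz b\<rbrakk> \<Longrightarrow> e b i j \<in> alg"
  unfolding alg_def units_def by (rule mat_vs.span_base) blast

lemma alg_induct [consumes 1, case_names base zero add scale]:
  assumes "M \<in> alg"
    and "\<And>b i j. \<lbrakk>b \<in> I; i < sz b; j < sz b\<rbrakk> \<Longrightarrow> P (e b i j)"
    and "P 0" and "\<And>M N. P M \<Longrightarrow> P N \<Longrightarrow> P (M + N)" and "\<And>c M. P M \<Longrightarrow> P (mscale c M)"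
  shows "P M"
proof -
  have "mat_vs.subspace (Collect P)"
    using assms by (auto simp: mat_vs.subspace_def)
  moreover have "units \<subseteq> Collect P"
    using assms by (auto simp: units_def)
  ultimately have "mat_vs.span units \<subseteq> Collect P"
    by (rule mat_vs.span_minimal[rotated])
  then show ?thesis
    using assms(1) by (auto simp: alg_def)
qed

lemma subspace_alg: "mat_vs.subspace alg"
  by (simp add: alg_def)

lemma matrix_subalgebra_alg: "matrix_subalgebra alg"
proof -
  have left: "e b i j ** N \<in> alg" if "b \<in> I" "i < sz b" "j < sz b" "N \<in> alg" for b i j N
    using that(4)
    by (induction rule: alg_induct)
      (auto simp: that(1-3) e_mult e_in_alg matrix_algebra subspace_alg mat_vs.subspace_0
        mat_vs.subspace_add mat_vs.subspace_scale)
  have "M ** N \<in> alg" if "M \<in> alg" "N \<in> alg" for M N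
    using that(1)
    by (induction rule: alg_induct)
      (auto simp: left that(2) matrix_algebra subspace_alg mat_vs.subspace_0
        mat_vs.subspace_add mat_vs.subspace_scale)
  moreover have "mat 1 \<in> alg"
    unfolding e_sum[symmetric]
    by (intro mat_vs.subspace_sum[OF subspace_alg] e_in_alg) auto
  ultimately show ?thesis
    by (simp add: matrix_subalgebra_def subspace_alg)
qed

text \<open>Multiplication by \<open>e b 0 i\<close> on the left and \<open>e b j 0\<close> on the
  right kills every unit except \<open>e b i j\<close>. This isolates single coefficients, so the
  units are distinct and independent.\<close>

lemma dim_alg: "mat_vs.dim alg = (\<Sum>b\<in>I. (sz b)\<^sup>2)"
proof -
  define X where "X = (SIGMA b:I. {..<sz b} \<times> {..<sz b})"
  define g where "g = (\<lambda>(b, i, j). e b i j)"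
  have X: "p \<in> X \<longleftrightarrow> (\<exists>b i j. p = (b, i, j) \<and> b \<in> I \<and> i < sz b \<and> j < sz b)" for p
    by (auto simp: X_def)
  have finX: "finite X"
    by (simp add: X_def finite_blocks)
  have sel: "e b 0 i ** g p ** e b j 0 = (if p = (b, i, j) then e b 0 0 else 0)"
    if "(b, i, j) \<in> X" "p \<in> X" for b i j p
    using that sz_pos by (auto simp: X g_def e_mult split: if_splits)
  have inj: "inj_on g X"
  proof (rule inj_onI)
    fix p q assume pq: "p \<in> X" "q \<in> X" "g p = g q"
    obtain b i j where p: "(b, i, j) = p"
      by (cases p) auto
    then have "e b 0 0 \<noteq> 0"
      using pq(1) e_nonzero by (auto simp: X)
    moreover have "e b 0 i ** g p ** e b j 0 = e b 0 0"
      using sel[of b i j p] pq(1) unfolding p by simp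
    moreover have "e b 0 i ** g q ** e b j 0 = (if q = p then e b 0 0 else 0)"
      using sel[of b i j q] pq(1,2) unfolding p by simp
    ultimately show "p = q"
      unfolding pq(3) by (simp split: if_splits)
  qed
  have image: "g ` X = units"
    by (auto simp: units_def g_def X_def image_iff) blast
  have "mat_vs.independent (g ` X)"
  proof (rule mat_vs.independent_if_scalars_zero)
    show "finite (g ` X)"
      using finX by simp
    fix a M assume sum0: "(\<Sum>M\<in>g ` X. mscale (a M) M) = 0" and M: "M \<in> g ` X"
    obtain b i j where p: "(b, i, j) \<in> X" "M = g (b, i, j)"
      using M by (auto simp: X)
    have "0 = e b 0 i ** (\<Sum>p\<in>X. mscale (a (g p)) (g p)) ** e b j 0"
      using sum0 by (simp add: sum.reindex[OF inj])
    also have "\<dots> = (\<Sum>p\<in>X. mscale (a (g p)) (e b 0 i ** g p ** e b j 0))"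
      by (simp add: matrix_sum_ldistrib matrix_sum_rdistrib mscale_mult_left mscale_mult_right)
    also have "\<dots> = (\<Sum>p\<in>X. if p = (b, i, j) then mscale (a M) (e b 0 0) else 0)"
      by (intro sum.cong refl) (auto simp: sel[OF p(1)] p(2))
    also have "\<dots> = mscale (a M) (e b 0 0)"
      using finX p by simp
    finally show "a M = 0"
      using e_nonzero p(1) by (simp add: X)
  qed
  then have "mat_vs.dim alg = card (g ` X)"
    unfolding alg_def image by (rule mat_vs.dim_span_eq_card_independent)
  also have "\<dots> = card X"
    by (rule card_image[OF inj])
  also have "\<dots> = (\<Sum>b\<in>I. (sz b)\<^sup>2)"
    by (simp add: X_def finite_blocks power2_eq_square)
  finally show ?thesis .
qed

text \<open>The left ideal generated by \<open>e b 0 0\<close> is column 0 of block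
  \<open>b\<close>, the model of the simple module of that block.\<close>

lemma alg_column:
  assumes "M \<in> alg" "b \<in> I"
  shows "\<exists>a. M ** e b 0 0 = (\<Sum>j<sz b. mscale (a j) (e b j 0))"
  using assms(1)
proof (induction rule: alg_induct)
  case (base c i j)
  show ?case
  proof (cases "c = b \<and> j = 0")
    case True
    then have "e c i j ** e b 0 0 = (\<Sum>k<sz b. mscale (if k = i then 1 else 0) (e b k 0))"
      using base assms sz_pos by (simp add: e_mult if_distrib if_distribR cong: if_cong)
    then show ?thesis
      by (intro exI)
  next
    case False
    then show ?thesis
      using base assms sz_pos by (intro exI[of _ "\<lambda>_. 0"]) (auto simp: e_mult)
  qed
next
  case zero
  show ?case
    by (intro exI[of _ "\<lambda>_. 0"]) simp
next
  case (add M N)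
  then obtain a a' where "M ** e b 0 0 = (\<Sum>j<sz b. mscale (a j) (e b j 0))"
    "N ** e b 0 0 = (\<Sum>j<sz b. mscale (a' j) (e b j 0))"
    by blast
  then show ?case
    by (intro exI[of _ "\<lambda>j. a j + a' j"])
      (simp add: matrix_algebra mat_vs.scale_left_distrib sum.distrib)
next
  case (scale c M)
  then obtain a where "M ** e b 0 0 = (\<Sum>j<sz b. mscale (a j) (e b j 0))"
    by blast
  then show ?case
    by (intro exI[of _ "\<lambda>j. c * a j"]) (simp add: matrix_algebra)
qed

end

section \<open>Modules over an algebra spanned by matrix units\<close>

locale algebra_module = matrix_units I sz e + vs: vector_space smul
  for I :: "'b set" and sz and e :: "'b \<Rightarrow> nat \<Rightarrow> nat \<Rightarrow> complex^'n::finite^'n"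
    and smul :: "complex \<Rightarrow> 'v::ab_group_add \<Rightarrow> 'v" +
  fixes W :: "'v set" and act :: "complex^'n^'n \<Rightarrow> 'v \<Rightarrow> 'v"
  assumes is_module: "is_module alg smul W act"
begin

lemma subspace_W: "vs.subspace W"
  and act_closed: "M \<in> alg \<Longrightarrow> v \<in> W \<Longrightarrow> act M v \<in> W"
  and act_add_right: "M \<in> alg \<Longrightarrow> v \<in> W \<Longrightarrow> w \<in> W \<Longrightarrow> act M (v + w) = act M v + act M w"
  and act_scale_right: "M \<in> alg \<Longrightarrow> v \<in> W \<Longrightarrow> act M (smul c v) = smul c (act M v)"
  and act_add_left: "M \<in> alg \<Longrightarrow> N \<in> alg \<Longrightarrow> v \<in> W \<Longrightarrow> act (M + N) v = act M v + act N v"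
  and act_scale_left: "M \<in> alg \<Longrightarrow> v \<in> W \<Longrightarrow> act (mscale c M) v = smul c (act M v)"
  and act_mult: "M \<in> alg \<Longrightarrow> N \<in> alg \<Longrightarrow> v \<in> W \<Longrightarrow> act (M ** N) v = act M (act N v)"
  and act_mat_1: "v \<in> W \<Longrightarrow> act (mat 1) v = v"
  using is_module unfolding is_module_def by auto

lemma act_zero_left: "v \<in> W \<Longrightarrow> act 0 v = 0"
  using act_scale_left[of 0 v 0] mat_vs.subspace_0[OF subspace_alg] by simp

lemma act_zero_right: "M \<in> alg \<Longrightarrow> act M 0 = 0"
  using act_scale_right[of M 0 0] vs.subspace_0[OF subspace_W] by simp

lemma act_sum_left:
  "\<lbrakk>\<And>i. i \<in> X \<Longrightarrow> f i \<in> alg; v \<in> W\<rbrakk> \<Longrightarrow> act (sum f X) v = (\<Sum>i\<in>X. act (f i) v)"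
  by (induction X rule: infinite_finite_induct)
    (simp_all add: act_zero_left act_add_left mat_vs.subspace_sum[OF subspace_alg])

lemma act_sum_right:
  "\<lbrakk>M \<in> alg; \<And>i. i \<in> X \<Longrightarrow> f i \<in> W\<rbrakk> \<Longrightarrow> act M (sum f X) = (\<Sum>i\<in>X. act M (f i))"
  by (induction X rule: infinite_finite_induct)
    (simp_all add: act_zero_right act_add_right vs.subspace_sum[OF subspace_W])

text \<open>A nonzero vector in the image of \<open>e b 0 0\<close>: it witnesses that block
  \<open>b\<close> occurs in \<open>W\<close>, and its orbit is the simple module of that
  block.\<close>

definition generator :: "'b \<Rightarrow> 'v \<Rightarrow> bool" where
  "generator b w \<longleftrightarrow> b \<in> I \<and> w \<in> W \<and> w \<noteq> 0 \<and> act (e b 0 0) w = w"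

text \<open>The diagonal units sum to the identity, so some \<open>e b i i\<close> does not kill
  \<open>v\<close>; \<open>e b 0 i\<close> moves the surviving component to index 0.\<close>

lemma generator_exists:
  assumes "W \<noteq> {0}"
  obtains b w where "generator b w"
proof -
  obtain v where v: "v \<in> W" "v \<noteq> 0"
    using assms vs.subspace_0[OF subspace_W] by blast
  have "v = act (\<Sum>b\<in>I. \<Sum>i<sz b. e b i i) v"
    by (simp add: e_sum act_mat_1 v)
  also have "\<dots> = (\<Sum>b\<in>I. act (\<Sum>i<sz b. e b i i) v)"
    by (rule act_sum_left) (auto intro!: mat_vs.subspace_sum[OF subspace_alg] e_in_alg v)
  also have "\<dots> = (\<Sum>b\<in>I. \<Sum>i<sz b. act (e b i i) v)"
    by (intro sum.cong refl act_sum_left) (auto intro: e_in_alg v)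
  finally obtain b i where b: "b \<in> I" "i < sz b" "act (e b i i) v \<noteq> 0"
    using v by (metis (no_types, lifting) lessThan_iff sum.neutral)
  let ?w = "act (e b 0 i) v"
  have "act (e b i 0) ?w = act (e b i i) v" "act (e b 0 0) ?w = ?w"
    using b v sz_pos by (simp_all add: e_in_alg e_mult flip: act_mult)
  then have "generator b ?w"
    using b v sz_pos by (auto simp: generator_def e_in_alg act_closed act_zero_right)
  then show ?thesis ..
qed

context
  fixes b w assumes gen: "generator b w"
begin

lemma gen_simps: "b \<in> I" "w \<in> W" "w \<noteq> 0" "act (e b 0 0) w = w" "0 < sz b"
  using gen sz_pos by (auto simp: generator_def)

lemma act_unit_generator:
  "c \<in> I \<Longrightarrow> i < sz c \<Longrightarrow> k < sz c \<Longrightarrow> j < sz b \<Longrightarrow>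
    act (e c i k) (act (e b j 0) w) = (if c = b \<and> k = j then act (e b i 0) w else 0)"
  using gen_simps by (simp add: e_in_alg e_mult act_zero_left flip: act_mult)

lemma act_generator:
  assumes "M \<in> alg" "M ** e b 0 0 = (\<Sum>j<sz b. mscale (a j) (e b j 0))"
  shows "act M w = (\<Sum>j<sz b. smul (a j) (act (e b j 0) w))"
proof -
  have "act M w = act (M ** e b 0 0) w"
    using assms(1) gen_simps by (simp add: act_mult e_in_alg)
  also have "\<dots> = (\<Sum>j<sz b. act (mscale (a j) (e b j 0)) w)"
    unfolding assms(2)
    by (rule act_sum_left) (auto intro!: mat_vs.subspace_scale[OF subspace_alg] e_in_alg gen_simps)
  also have "\<dots> = (\<Sum>j<sz b. smul (a j) (act (e b j 0) w))"
    by (intro sum.cong refl act_scale_left) (auto intro: e_in_alg gen_simps)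
  finally show ?thesis .
qed

lemma act_combination:
  assumes "M \<in> alg"
  shows "act M (\<Sum>j<sz b. smul (a j) (act (e b j 0) w)) =
    (\<Sum>j<sz b. smul (a j) (act M (act (e b j 0) w)))"
proof -
  have "act M (\<Sum>j<sz b. smul (a j) (act (e b j 0) w)) =
    (\<Sum>j<sz b. act M (smul (a j) (act (e b j 0) w)))"
    by (rule act_sum_right[OF assms])
      (auto intro!: vs.subspace_scale[OF subspace_W] act_closed e_in_alg gen_simps)
  also have "\<dots> = (\<Sum>j<sz b. smul (a j) (act M (act (e b j 0) w)))"
    by (intro sum.cong refl act_scale_right[OF assms])
      (auto intro!: act_closed e_in_alg gen_simps)
  finally show ?thesis .
qed

text \<open>\<open>e b 0 i\<close> reads off the \<open>i\<close>-th coordinate of an orbit vector.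
  This extraction yields the annihilator, the irreducibility and the dimension of the orbit.\<close>

lemma act_unit_combination:
  assumes "i < sz b"
  shows "act (e b 0 i) (\<Sum>j<sz b. smul (a j) (act (e b j 0) w)) = smul (a i) w"
proof -
  have "act (e b 0 i) (\<Sum>j<sz b. smul (a j) (act (e b j 0) w)) =
    (\<Sum>j<sz b. smul (a j) (act (e b 0 i) (act (e b j 0) w)))"
    using gen_simps assms by (simp add: act_combination e_in_alg)
  also have "\<dots> = (\<Sum>j<sz b. if j = i then smul (a i) w else 0)"
    using gen_simps assms by (intro sum.cong) (auto simp: act_unit_generator)
  finally show ?thesis
    using assms by simp
qed

text \<open>The annihilator of a generator depends on its block alone, as
  \<open>cyclic_modules_isomorphic\<close> requires for two generators of one block.\<close>

lemma annihilator_generator: "M \<in> alg \<Longrightarrow> act M w = 0 \<longleftrightarrow> M ** e b 0 0 = 0"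
proof
  assume M: "M \<in> alg" and "act M w = 0"
  obtain a where a: "M ** e b 0 0 = (\<Sum>j<sz b. mscale (a j) (e b j 0))"
    using alg_column[OF M] gen_simps by blast
  have "a i = 0" if "i < sz b" for i
    using act_unit_combination[OF that, of a] \<open>act M w = 0\<close> that gen_simps
    by (simp add: act_generator[OF M a] act_zero_right e_in_alg)
  then show "M ** e b 0 0 = 0"
    unfolding a by simp
next
  assume "M \<in> alg" "M ** e b 0 0 = 0"
  then show "act M w = 0"
    using act_mult[of M "e b 0 0" w] gen_simps by (simp add: act_zero_left e_in_alg)
qed

lemma subspace_orbit: "vs.subspace {act M w | M. M \<in> alg}"
  unfolding vs.subspace_def
proof (intro conjI ballI allI)
  note [simp] = mat_vs.subspace_0[OF subspace_alg] mat_vs.subspace_add[OF subspace_alg]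
    mat_vs.subspace_scale[OF subspace_alg]
  show "0 \<in> {act M w | M. M \<in> alg}"
    using gen_simps act_zero_left[of w] by (auto intro!: exI[of _ 0])
  show "x + y \<in> {act M w | M. M \<in> alg}"
    if "x \<in> {act M w | M. M \<in> alg}" "y \<in> {act M w | M. M \<in> alg}" for x y
    using that gen_simps by (auto simp flip: act_add_left)
  show "smul c x \<in> {act M w | M. M \<in> alg}" if "x \<in> {act M w | M. M \<in> alg}" for c x
    using that gen_simps by (auto simp flip: act_scale_left)
qed

lemma irreducible_orbit:
  assumes "irreducible_module alg smul W act"
  shows "W = {act M w | M. M \<in> alg}"
proof -
  have "{act M w | M. M \<in> alg} \<subseteq> W"
    using gen_simps act_closed by auto
  moreover have "\<forall>M\<in>alg. \<forall>v\<in>{act M w | M. M \<in> alg}. act M v \<in> {act M w | M. M \<in> alg}"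
    using gen_simps matrix_subalgebra_mult[OF matrix_subalgebra_alg] by (auto simp flip: act_mult)
  moreover have "w \<in> {act M w | M. M \<in> alg}"
    using gen_simps by (metis (mono_tags, lifting) e_in_alg mem_Collect_eq)
  moreover note subspace_orbit
  ultimately have "{act M w | M. M \<in> alg} = {0} \<or> {act M w | M. M \<in> alg} = W"
    using assms unfolding irreducible_module_def by blast
  then show ?thesis
    using \<open>w \<in> {act M w | M. M \<in> alg}\<close> gen_simps(3) by blast
qed

text \<open>A nonzero vector of a submodule has a coordinate \<open>a i \<noteq> 0\<close>; applying
  \<open>e b 0 i\<close> and dividing by \<open>a i\<close> puts the generator into the
  submodule.\<close>

lemma orbit_irreducible:
  assumes W: "W = {act M w | M. M \<in> alg}"
  shows "irreducible_module alg smul W act"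
  unfolding irreducible_module_def
proof (intro conjI allI impI)
  show "is_module alg smul W act"
    by (rule is_module)
  show "W \<noteq> {0}"
    using gen_simps by auto
  fix U assume U: "vs.subspace U \<and> U \<subseteq> W \<and> (\<forall>M\<in>alg. \<forall>u\<in>U. act M u \<in> U)"
  show "U = {0} \<or> U = W"
  proof (cases "U = {0}")
    case False
    then obtain v where v: "v \<in> U" "v \<noteq> 0"
      using U vs.subspace_0 by blast
    then obtain M where M: "M \<in> alg" "v = act M w"
      using U W by auto
    obtain a where a: "M ** e b 0 0 = (\<Sum>j<sz b. mscale (a j) (e b j 0))"
      using alg_column[OF M(1)] gen_simps by blast
    have "v = 0" if "\<forall>i<sz b. a i = 0"
      unfolding M(2) act_generator[OF M(1) a] using that by simp
    then obtain i where i: "i < sz b" "a i \<noteq> 0"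
      using v(2) by blast
    have "act (e b 0 i) v = smul (a i) w"
      unfolding M(2) act_generator[OF M(1) a] by (rule act_unit_combination[OF i(1)])
    then have "smul (a i) w \<in> U"
      using U v(1) e_in_alg[of b 0 i] i gen_simps by force
    then have "smul (inverse (a i)) (smul (a i) w) \<in> U"
      using U vs.subspace_scale by blast
    then have "w \<in> U"
      using i by simp
    then have "W \<subseteq> U"
      using U W by auto
    then show ?thesis
      using U by auto
  qed simp
qed

lemma dim_orbit:
  assumes W: "W = {act M w | M. M \<in> alg}"
  shows "vs.dim W = sz b"
proof -
  define g where "g j = act (e b j 0) w" for j
  have inj: "inj_on g {..<sz b}"
  proof (rule inj_onI)
    fix i j assume ij: "i \<in> {..<sz b}" "j \<in> {..<sz b}" "g i = g j"
    have "w = act (e b 0 i) (g i)"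
      using ij(1) gen_simps by (simp add: g_def act_unit_generator)
    also have "\<dots> = (if i = j then w else 0)"
      using ij(1,2) gen_simps unfolding ij(3) by (simp add: g_def act_unit_generator)
    finally show "i = j"
      using gen_simps(3) by (auto split: if_splits)
  qed
  have "vs.independent (g ` {..<sz b})"
  proof (rule vs.independent_if_scalars_zero)
    fix f x assume *: "(\<Sum>x\<in>g ` {..<sz b}. smul (f x) x) = 0" and "x \<in> g ` {..<sz b}"
    then obtain i where i: "i < sz b" "x = g i"
      by auto
    have "0 = act (e b 0 i) (\<Sum>j<sz b. smul (f (g j)) (act (e b j 0) w))"
      using * i gen_simps by (simp add: sum.reindex[OF inj] act_zero_right e_in_alg flip: g_def)
    then show "f x = 0"
      using i gen_simps by (simp add: act_unit_combination)
  qed simp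
  moreover have "g ` {..<sz b} \<subseteq> W"
    using gen_simps by (auto simp: g_def act_closed e_in_alg)
  moreover have "W \<subseteq> vs.span (g ` {..<sz b})"
  proof
    fix v assume "v \<in> W"
    then obtain M where M: "M \<in> alg" "v = act M w"
      using W by auto
    obtain a where a: "M ** e b 0 0 = (\<Sum>j<sz b. mscale (a j) (e b j 0))"
      using alg_column[OF M(1)] gen_simps by blast
    show "v \<in> vs.span (g ` {..<sz b})"
      unfolding M(2) act_generator[OF M(1) a] g_def[symmetric]
      by (intro vs.span_sum vs.span_scale vs.span_base) auto
  qed
  ultimately have "vs.dim W = card (g ` {..<sz b})"
    by (metis vs.basis_card_eq_dim)
  then show ?thesis
    using card_image[OF inj] by simp
qed

text \<open>For \<open>c \<noteq> b\<close> the unit \<open>e c 0 0\<close> kills all vectors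
  \<open>act (e b j 0) w\<close>, and these span \<open>W\<close>.\<close>

lemma generator_unique:
  assumes W: "W = {act M w | M. M \<in> alg}" and "generator c v"
  shows "c = b"
proof (rule ccontr)
  assume "c \<noteq> b"
  have c: "c \<in> I" "v \<in> W" "v \<noteq> 0" "act (e c 0 0) v = v"
    using assms(2) by (auto simp: generator_def)
  obtain M where M: "M \<in> alg" "v = act M w"
    using W c by auto
  obtain a where a: "M ** e b 0 0 = (\<Sum>j<sz b. mscale (a j) (e b j 0))"
    using alg_column[OF M(1)] gen_simps by blast
  have "v = act (e c 0 0) (\<Sum>j<sz b. smul (a j) (act (e b j 0) w))"
    using c(4) unfolding M(2) act_generator[OF M(1) a] by simp
  also have "\<dots> = (\<Sum>j<sz b. smul (a j) (act (e c 0 0) (act (e b j 0) w)))"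
    using c sz_pos by (simp add: act_combination e_in_alg)
  also have "\<dots> = 0"
    using gen_simps c sz_pos \<open>c \<noteq> b\<close> by (simp add: act_unit_generator)
  finally show False
    using c by simp
qed

end

end

context matrix_units
begin

abbreviation generates :: "('v::ab_group_add) set \<Rightarrow> (complex^'n^'n \<Rightarrow> 'v \<Rightarrow> 'v) \<Rightarrow> 'b \<Rightarrow> 'v \<Rightarrow> bool" where
  "generates \<equiv> algebra_module.generator I e"

lemma algebra_moduleI:
  assumes "vector_space smul" "is_module alg smul W act"
  shows "algebra_module I sz e smul W act"
  using assms by (simp add: algebra_module_def algebra_module_axioms_def matrix_units_axioms)

lemma irreducible_module_generator:
  assumes "vector_space smul" "irreducible_module alg smul W act"
  obtains b w where "b \<in> I" "generates W act b w" "W = {act M w | M. M \<in> alg}"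
    "vector_space.dim smul W = sz b"
proof -
  interpret algebra_module I sz e smul W act
    using assms by (simp add: algebra_moduleI irreducible_module_def)
  have "W \<noteq> {0}"
    using assms(2) by (simp add: irreducible_module_def)
  then obtain b w where bw: "generator b w"
    by (rule generator_exists)
  have W: "W = {act M w | M. M \<in> alg}"
    by (rule irreducible_orbit[OF bw assms(2)])
  show ?thesis
    using that[OF gen_simps(1)[OF bw] bw W dim_orbit[OF bw W]] .
qed

text \<open>Generators of one block have the same annihilator. Conversely an isomorphism carries a
  generator of block \<open>b\<close> to a generator of block \<open>b\<close>, and the block of a
  module is unique.\<close>

lemma isomorphic_iff_same_block:
  assumes "vector_space smul" "is_module alg smul W act" "generates W act b w"
      "W = {act M w | M. M \<in> alg}"
    and "vector_space smul'" "is_module alg smul' W' act'" "generates W' act' b' w'"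
      "W' = {act' M w' | M. M \<in> alg}"
  shows "modules_isomorphic alg smul W act smul' W' act' \<longleftrightarrow> b = b'"
proof -
  interpret V: algebra_module I sz e smul W act
    using assms by (simp add: algebra_moduleI)
  interpret V': algebra_module I sz e smul' W' act'
    using assms by (simp add: algebra_moduleI)
  note g = V.gen_simps[OF assms(3)] and g' = V'.gen_simps[OF assms(7)]
  show ?thesis
  proof
    assume "b = b'"
    then show "modules_isomorphic alg smul W act smul' W' act'"
      by (intro cyclic_modules_isomorphic[where w = w and w' = w'] matrix_subalgebra_alg assms g g')
        (use V.annihilator_generator[OF assms(3)] V'.annihilator_generator[OF assms(7)] in simp)
  next
    assume "modules_isomorphic alg smul W act smul' W' act'"
    then obtain f where f: "bij_betw f W W'" "\<And>v z. v \<in> W \<Longrightarrow> z \<in> W \<Longrightarrow> f (v + z) = f v + f z"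
      "\<And>M v. M \<in> alg \<Longrightarrow> v \<in> W \<Longrightarrow> f (act M v) = act' M (f v)"
      unfolding modules_isomorphic_def by blast
    have "0 \<in> W"
      by (rule V.vs.subspace_0[OF V.subspace_W])
    then have "f 0 = 0"
      using f(2)[of 0 0] by simp
    then have "f w \<noteq> 0"
      using f(1) g \<open>0 \<in> W\<close> by (metis bij_betw_inv_into_left)
    moreover have "f w \<in> W'"
      using f(1) g by (auto simp: bij_betw_def)
    moreover have "act' (e b 0 0) (f w) = f w"
      using f(3)[of "e b 0 0" w] g by (simp add: e_in_alg)
    ultimately have "generates W' act' b (f w)"
      using g by (simp add: V'.generator_def)
    then show "b = b'"
      by (rule V'.generator_unique[OF assms(7,8)])
  qed
qed

lemma standard_submodule:
  "is_module alg (*s) {M *v v | M. M \<in> alg} (*v)"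
proof -
  note closed = matrix_subalgebra_closed[OF matrix_subalgebra_alg]
  have "vec.subspace {M *v v | M. M \<in> alg}"
    unfolding vec.subspace_def
    by (auto simp flip: matrix_vector_mult_add_rdistrib mscale_vector_mult)
      (metis closed(6) matrix_vector_mult_0, metis closed(3), metis closed(5))
  moreover have "M *v (N *v v) \<in> {M *v v | M. M \<in> alg}" if "M \<in> alg" "N \<in> alg" for M N
    using that closed(2) by (auto simp: matrix_vector_mul_assoc)
  ultimately show ?thesis
    unfolding is_module_def
    by (auto simp: matrix_vector_right_distrib matrix_vector_mult_add_rdistrib vec.scale
        mscale_vector_mult matrix_vector_mul_assoc)
qed

lemma standard_submodule_generator:
  assumes "b \<in> I" "e b 0 0 *v w = w" "w \<noteq> 0"
  shows "generates {M *v w | M. M \<in> alg} (*v) b w"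
    and "irreducible_module alg (*s) {M *v w | M. M \<in> alg} (*v)"
proof -
  interpret algebra_module I sz e "(*s)" "{M *v w | M. M \<in> alg}" "(*v)"
    by (intro algebra_moduleI standard_submodule vec.vector_space_axioms)
  show gen: "generator b w"
    using assms sz_pos e_in_alg[of b 0 0] by (auto simp: generator_def intro!: exI[of _ "e b 0 0"])
  show "irreducible_module alg (*s) {M *v w | M. M \<in> alg} (*v)"
    by (rule orbit_irreducible[OF gen refl])
qed

text \<open>\<open>t\<close> reads off the block of a module and takes equal values exactly on
  isomorphic modules. Every block of size \<open>d\<close> is attained by an orbit inside the
  standard module.\<close>

lemma iso_classes_dim_card:
  "finite (iso_classes_dim alg d)" "card (iso_classes_dim alg d) = card {b \<in> I. sz b = d}"
proof -
  define X where "X = irreducible_modules_dim alg d"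
  define t where "t = (\<lambda>(W, act). THE b. \<exists>w. generates W act b (w :: complex^'n))"
  note vs = vec.vector_space_axioms
  have XD: "irreducible_module alg (*s) W act" "is_module alg (*s) W act" "vec.dim W = d"
    if "(W, act) \<in> X" for W act
    using that by (auto simp: X_def irreducible_modules_dim_def irreducible_module_def)
  have t_eq: "t (W, act) = b"
    if "is_module alg (*s) W act" "generates W act b w" "W = {act M w | M. M \<in> alg}" for W act b w
  proof -
    interpret algebra_module I sz e "(*s)" W act
      by (rule algebra_moduleI[OF vs that(1)])
    show ?thesis
      unfolding t_def case_prod_conv
    proof (rule the_equality)
      show "\<exists>w. generator b w"
        using that(2) by blast
      show "c = b" if "\<exists>w. generator c w" for c
        using that generator_unique[OF \<open>generator b w\<close> \<open>W = _\<close>] by blast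
    qed
  qed
  have iso: "modules_isomorphic alg (*s) W act (*s) W' act' \<longleftrightarrow> t (W, act) = t (W', act')"
    if h: "(W, act) \<in> X" "(W', act') \<in> X" for W act W' act'
  proof -
    obtain b w where 1: "generates W act b w" "W = {act M w | M. M \<in> alg}"
      using irreducible_module_generator[OF vs XD(1)[OF h(1)]] by blast
    obtain b' w' where 2: "generates W' act' b' w'" "W' = {act' M w' | M. M \<in> alg}"
      using irreducible_module_generator[OF vs XD(1)[OF h(2)]] by blast
    show ?thesis
      using isomorphic_iff_same_block[OF vs XD(2)[OF h(1)] 1 vs XD(2)[OF h(2)] 2]
        t_eq[OF XD(2)[OF h(1)] 1] t_eq[OF XD(2)[OF h(2)] 2] by simp
  qed
  have image: "t ` X = {b \<in> I. sz b = d}"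
  proof (intro equalityI subsetI)
    fix b assume "b \<in> t ` X"
    then obtain W act where W: "(W, act) \<in> X" "b = t (W, act)"
      by auto
    obtain c w where "c \<in> I" "generates W act c w" "W = {act M w | M. M \<in> alg}" "vec.dim W = sz c"
      by (rule irreducible_module_generator[OF vs XD(1)[OF W(1)]])
    then show "b \<in> {b \<in> I. sz b = d}"
      using t_eq[OF XD(2)[OF W(1)]] XD(3)[OF W(1)] W by auto
  next
    fix b assume b: "b \<in> {b \<in> I. sz b = d}"
    obtain v where v: "e b 0 0 *v v \<noteq> 0"
      using e_nonzero[of b] b by (auto simp: matrix_eq)
    define w where "w = e b 0 0 *v v"
    define W where "W = {M *v w | M. M \<in> alg}"
    have w: "b \<in> I" "e b 0 0 *v w = w" "w \<noteq> 0"
      using b v sz_pos by (auto simp: w_def matrix_vector_mul_assoc e_mult)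
    note gen = standard_submodule_generator[OF w, folded W_def]
    have mod: "is_module alg (*s) W (*v)"
      unfolding W_def by (rule standard_submodule)
    interpret algebra_module I sz e "(*s)" W "(*v)"
      by (rule algebra_moduleI[OF vs mod])
    have "(W, (*v)) \<in> X"
      using gen(2) dim_orbit[OF gen(1) W_def] b
      by (simp add: X_def irreducible_modules_dim_def)
    moreover have "t (W, (*v)) = b"
      by (rule t_eq[OF mod gen(1) W_def])
    ultimately show "b \<in> t ` X"
      by force
  qed
  have rel: "{((W, act), (W', act')). (W, act) \<in> X \<and> (W', act') \<in> X \<and>
      modules_isomorphic alg (*s) W act (*s) W' act'} = {(p, q). p \<in> X \<and> q \<in> X \<and> t p = t q}"
    using iso by auto
  have "iso_classes_dim alg d = X // {(p, q). p \<in> X \<and> q \<in> X \<and> t p = t q}"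
    unfolding iso_classes_dim_def X_def[symmetric] rel ..
  then show "finite (iso_classes_dim alg d)" "card (iso_classes_dim alg d) = card {b \<in> I. sz b = d}"
    using finite_quotient_fibres[of t X] card_quotient_fibres[of X t] finite_blocks
    by (simp_all add: image)
qed

end

section \<open>The complement of the primary module\<close>

text \<open>\<open>F1\<close> and \<open>F2\<close> stand for the projections onto \<open>V\<^sub>1\<close> and \<open>V\<^sub>2\<close>.\<close>

locale corner =
  fixes F1 F2 A :: "complex^'n::finite^'n" and u :: nat and \<alpha> \<beta> :: complex
  assumes F_mult: "F1 ** F1 = F1" "F2 ** F2 = F2" "F1 ** F2 = 0" "F2 ** F1 = 0"
    and F_adjoint: "adjoint_matrix F1 = F1" "adjoint_matrix F2 = F2"
    and F_transpose: "transpose F1 = F1" "transpose F2 = F2"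
    and A_commute: "A ** (F1 + F2) = (F1 + F2) ** A"
    and A_adjoint: "(F1 + F2) ** adjoint_matrix A = - (F1 + F2) - (F1 + F2) ** A"
    and A_transpose: "(F1 + F2) ** transpose A = - (F1 + F2) - (F1 + F2) ** A"
    and A_square: "(F1 + F2) ** (A ** A) + (F1 + F2) ** A + mscale (of_nat (u + 1)) (F1 + F2) = 0"
    and F_trace: "trace F1 = of_nat (2 * u)" "trace F2 = of_nat (2 * u)"
    and \<alpha>\<beta>: "\<alpha> \<noteq> \<beta>" "\<alpha> + \<beta> = - 1" "\<alpha> * \<beta> = of_nat (u + 1)"
begin

section \<open>Blocks of \<open>A\<close> and the relations between them\<close>

definition "b = F1 ** (A ** F1)"
definition "c = F1 ** (A ** F2)"
definition "d = F2 ** (A ** F1)"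
definition "e = F2 ** (A ** F2)"

lemmas F_mult_assoc = F_mult[THEN matrix_mult_eq_assoc]

lemma F_abcd [simp]:
  "F1 ** b = b" "F1 ** c = c" "F1 ** d = 0" "F1 ** e = 0"
  "F2 ** b = 0" "F2 ** c = 0" "F2 ** d = d" "F2 ** e = e"
  "b ** F1 = b" "c ** F1 = 0" "d ** F1 = d" "e ** F1 = 0"
  "b ** F2 = 0" "c ** F2 = c" "d ** F2 = 0" "e ** F2 = e"
  by (simp_all add: b_def c_def d_def e_def F_mult F_mult_assoc flip: matrix_mul_assoc)

lemmas F_abcd_assoc [simp] = F_abcd[THEN matrix_mult_eq_assoc]

lemma F_A: "F1 ** A = b + c" "F2 ** A = d + e" "A ** F1 = b + d" "A ** F2 = c + e"
proof -
  have 1: "F1 ** A = F1 ** ((F1 + F2) ** A)" "F2 ** A = F2 ** ((F1 + F2) ** A)"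
    by (simp_all add: matrix_algebra F_mult F_mult_assoc)
  show "F1 ** A = b + c" "F2 ** A = d + e"
    unfolding 1 A_commute[symmetric]
    by (simp_all add: b_def c_def d_def e_def matrix_algebra)
  have 2: "A ** F1 = (A ** (F1 + F2)) ** F1" "A ** F2 = (A ** (F1 + F2)) ** F2"
    by (simp_all add: matrix_algebra F_mult F_mult_assoc)
  show "A ** F1 = b + d" "A ** F2 = c + e"
    unfolding 2 A_commute
    by (simp_all add: b_def c_def d_def e_def matrix_algebra)
qed

lemma A_F: "A ** (F1 + F2) = b + c + d + e"
  by (simp add: matrix_algebra F_A)

lemma abcd_mult [simp]:
  "b ** d = 0" "b ** e = 0" "c ** b = 0" "c ** c = 0"
  "d ** d = 0" "d ** e = 0" "e ** b = 0" "e ** c = 0"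
  by (simp_all add: b_def c_def d_def e_def F_mult F_mult_assoc flip: matrix_mul_assoc)

lemmas abcd_mult_assoc [simp] = abcd_mult[THEN matrix_mult_eq_assoc]

lemma sandwich: "X ** (A ** A) ** Y + X ** A ** Y + mscale (of_nat (u + 1)) (X ** Y) = 0"
  if "X ** (F1 + F2) = X"
proof -
  have "X ** ((F1 + F2) ** (A ** A) + (F1 + F2) ** A + mscale (of_nat (u + 1)) (F1 + F2)) ** Y = 0"
    by (simp only: A_square matrix_mult_0)
  also have "X ** ((F1 + F2) ** (A ** A) + (F1 + F2) ** A + mscale (of_nat (u + 1)) (F1 + F2)) ** Y =
    (X ** (F1 + F2)) ** (A ** A) ** Y + (X ** (F1 + F2)) ** A ** Y
      + mscale (of_nat (u + 1)) ((X ** (F1 + F2)) ** Y)"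
    by (simp add: matrix_algebra)
  finally show ?thesis
    by (simp only: that)
qed

text \<open>The four block entries of the quadratic equation for \<open>A\<close>. The outer two
  express \<open>c ** d\<close> by \<open>b\<close> and \<open>d ** c\<close> by \<open>e\<close>;
  the middle two say that \<open>c\<close> and \<open>d\<close> intertwine \<open>b\<close> with
  \<open>- 1 - e\<close>.\<close>

lemma relations:
  "b ** b + c ** d + b + mscale (of_nat (u + 1)) F1 = 0"
  "b ** c + c ** e + c = 0"
  "d ** b + e ** d + d = 0"
  "d ** c + e ** e + e + mscale (of_nat (u + 1)) F2 = 0"
proof -
  have F: "F1 ** (F1 + F2) = F1" "F2 ** (F1 + F2) = F2"
    by (simp_all add: matrix_algebra F_mult)
  have expand: "X ** (A ** A) ** Y = (X ** A) ** (A ** Y)" for X Y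
    by (simp add: matrix_mul_assoc)
  show "b ** b + c ** d + b + mscale (of_nat (u + 1)) F1 = 0"
    using sandwich[OF F(1), of F1] unfolding expand F_A by (simp add: matrix_algebra F_mult)
  show "b ** c + c ** e + c = 0"
    using sandwich[OF F(1), of F2] unfolding expand F_A by (simp add: matrix_algebra F_mult)
  show "d ** b + e ** d + d = 0"
    using sandwich[OF F(2), of F1] unfolding expand F_A
    by (simp add: matrix_algebra F_mult add_ac)
  show "d ** c + e ** e + e + mscale (of_nat (u + 1)) F2 = 0"
    using sandwich[OF F(2), of F2] unfolding expand F_A by (simp add: matrix_algebra F_mult)
qed

text \<open>\<open>A'\<close> stands for the adjoint or the transpose of \<open>A\<close>, both of
  which act as \<open>- 1 - A\<close> on the complement of the primary module.\<close>

lemma sandwich_dual: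
  assumes "(F1 + F2) ** A' = - (F1 + F2) - (F1 + F2) ** A" "X ** (F1 + F2) = X"
  shows "X ** (A' ** Y) = - (X ** Y) - X ** (A ** Y)"
proof -
  have "X ** (A' ** Y) = X ** ((F1 + F2) ** A' ** Y)"
    using assms(2) by (metis matrix_mul_assoc)
  also have "\<dots> = - (X ** (F1 + F2) ** Y) - X ** (F1 + F2) ** A ** Y"
    unfolding assms(1) by (simp add: matrix_algebra)
  finally show ?thesis
    by (simp add: assms(2) matrix_mul_assoc)
qed

lemma abcd_adjoint:
  "adjoint_matrix b = - F1 - b" "adjoint_matrix c = - d"
  "adjoint_matrix d = - c" "adjoint_matrix e = - F2 - e"
proof -
  have F: "F1 ** (F1 + F2) = F1" "F2 ** (F1 + F2) = F2"
    by (simp_all add: matrix_algebra F_mult)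
  show "adjoint_matrix b = - F1 - b" "adjoint_matrix c = - d"
    "adjoint_matrix d = - c" "adjoint_matrix e = - F2 - e"
    by (simp_all add: b_def c_def d_def e_def adjoint_matrix_mult F_adjoint
        sandwich_dual[OF A_adjoint F(1)] sandwich_dual[OF A_adjoint F(2)] F_mult
        flip: matrix_mul_assoc)
qed

lemma abcd_transpose:
  "transpose b = - F1 - b" "transpose c = - d" "transpose d = - c" "transpose e = - F2 - e"
proof -
  have F: "F1 ** (F1 + F2) = F1" "F2 ** (F1 + F2) = F2"
    by (simp_all add: matrix_algebra F_mult)
  show "transpose b = - F1 - b" "transpose c = - d" "transpose d = - c" "transpose e = - F2 - e"
    by (simp_all add: b_def c_def d_def e_def matrix_transpose_mul F_transpose
        sandwich_dual[OF A_transpose F(1)] sandwich_dual[OF A_transpose F(2)] F_mult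
        flip: matrix_mul_assoc)
qed

text \<open>The adjoint \<open>- F1 - b\<close> is a polynomial in \<open>b\<close>, with
  \<open>F1\<close> in the role of the unit.\<close>

lemma b_normal: "b ** adjoint_matrix b = adjoint_matrix b ** b"
  by (simp add: abcd_adjoint matrix_algebra)

end

text \<open>\<open>b\<close> is a matrix on the whole space, so \<open>P 0\<close> turns out to be
  the projection onto the complement of \<open>V\<^sub>1\<close>, while the other \<open>P l\<close>
  decompose \<open>F1\<close>.\<close>

locale corner_spectral = corner F1 F2 A u \<alpha> \<beta>
  for F1 F2 A :: "complex^'n::finite^'n" and u \<alpha> \<beta> +
  fixes \<Lambda> :: "complex set" and P :: "complex \<Rightarrow> complex^'n^'n"
  assumes finite_\<Lambda>: "finite \<Lambda>"
    and P_nonzero: "\<And>l. l \<in> \<Lambda> \<longleftrightarrow> P l \<noteq> 0"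
    and b_P: "\<And>l. b ** P l = mscale l (P l)"
    and P_b: "\<And>l. P l ** b = mscale l (P l)"
    and P_mult: "\<And>l m. P l ** P m = (if l = m then P l else 0)"
    and P_sum: "(\<Sum>l\<in>\<Lambda>. P l) = mat 1"
begin

lemma F1_P: "F1 ** P l = P l" and P_F1: "P l ** F1 = P l" if "l \<noteq> 0"
proof -
  have "mscale l (F1 ** P l) = F1 ** (b ** P l)"
    by (simp add: b_P matrix_algebra)
  also have "\<dots> = (F1 ** b) ** P l"
    by (rule matrix_mul_assoc)
  also have "\<dots> = mscale l (P l)"
    by (simp add: b_P)
  finally show "F1 ** P l = P l"
    using that by simp
  have "mscale l (P l ** F1) = (P l ** b) ** F1"
    by (simp add: P_b matrix_algebra)
  also have "\<dots> = P l ** (b ** F1)"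
    by (rule matrix_mul_assoc[symmetric])
  also have "\<dots> = mscale l (P l)"
    by (simp add: P_b)
  finally show "P l ** F1 = P l"
    using that by simp
qed

text \<open>Since \<open>b\<close> and its adjoint sum to \<open>- F1\<close>, the equation
  \<open>b ** X = 0\<close> on \<open>V\<^sub>1\<close> gives
  \<open>adjoint_matrix b ** X = - X\<close>, and pairing with \<open>X\<close> gives
  \<open>adjoint_matrix X ** X = 0\<close>. So 0 is not an eigenvalue of \<open>b\<close> on
  \<open>V\<^sub>1\<close>.\<close>

lemma F1_P_0: "F1 ** P 0 = 0"
proof -
  define X where "X = F1 ** P 0"
  have F1X: "F1 ** X = X"
    by (simp add: X_def F_mult matrix_mul_assoc)
  have bX: "b ** X = 0"
    using b_P[of 0] by (simp add: X_def)
  have "adjoint_matrix X ** (adjoint_matrix b ** X) = adjoint_matrix (b ** X) ** X"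
    by (simp add: adjoint_matrix_mult matrix_mul_assoc)
  moreover have "adjoint_matrix b ** X = - X"
    by (simp add: abcd_adjoint matrix_algebra F1X bX)
  ultimately have "adjoint_matrix X ** X = 0"
    by (simp add: bX matrix_algebra)
  then show ?thesis
    by (simp add: adjoint_mult_eq_0_iff X_def)
qed

lemma F1_sum: "F1 = (\<Sum>l\<in>\<Lambda>-{0}. P l)"
proof -
  have "F1 = F1 ** (\<Sum>l\<in>\<Lambda>. P l)"
    by (simp add: P_sum)
  also have "\<dots> = (\<Sum>l\<in>\<Lambda>. if l = 0 then 0 else P l)"
    unfolding matrix_sum_ldistrib by (intro sum.cong) (auto simp: F1_P F1_P_0)
  also have "\<dots> = (\<Sum>l\<in>\<Lambda>-{0}. P l)"
    using finite_\<Lambda> by (intro sum.mono_neutral_cong_right) auto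
  finally show ?thesis .
qed

lemma \<alpha>\<beta>_nonzero: "\<alpha> \<noteq> 0" "\<beta> \<noteq> 0"
proof -
  have "\<alpha> * \<beta> \<noteq> 0"
    unfolding \<alpha>\<beta>(3) of_nat_eq_0_iff by simp
  then show "\<alpha> \<noteq> 0" "\<beta> \<noteq> 0"
    by auto
qed

text \<open>The polynomial annihilating \<open>A\<close> on the complement of the primary module;
  \<open>c ** d\<close> is its negative evaluated at \<open>b\<close>.\<close>

definition q :: "complex \<Rightarrow> complex" where
  "q l = (l - \<alpha>) * (l - \<beta>)"

lemma q_eq: "q l = l * l + l + of_nat (u + 1)"
proof -
  have "q l = l * l - (\<alpha> + \<beta>) * l + \<alpha> * \<beta>"
    by (simp add: q_def algebra_simps)
  then show ?thesis
    by (simp add: \<alpha>\<beta>)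
qed

lemma cd_eq: "c ** d = - (b ** b) - b - mscale (of_nat (u + 1)) F1"
  using relations(1) by (simp add: algebra_simps eq_neg_iff_add_eq_0)

lemma cd_P: "c ** (d ** P l) = mscale (- q l) (P l)"
  and P_cd: "P l ** (c ** d) = mscale (- q l) (P l)" if "l \<noteq> 0"
proof -
  have "c ** (d ** P l) = (c ** d) ** P l"
    by (rule matrix_mul_assoc)
  also have "\<dots> = - mscale (l * l) (P l) - mscale l (P l) - mscale (of_nat (u + 1)) (P l)"
    unfolding cd_eq by (simp add: matrix_algebra b_P F1_P that)
  also have "\<dots> = mscale (- q l) (P l)"
    by (simp add: q_eq mat_vs.scale_left_distrib mat_vs.scale_left_diff_distrib)
  finally show "c ** (d ** P l) = mscale (- q l) (P l)" .
  have "P l ** b ** b = mscale (l * l) (P l)"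
    by (simp add: P_b matrix_algebra)
  then have "P l ** (c ** d) = - mscale (l * l) (P l) - mscale l (P l) - mscale (of_nat (u + 1)) (P l)"
    unfolding cd_eq by (simp add: matrix_diff_ldistrib matrix_minus_ldistrib matrix_add_ldistrib
        mscale_mult_right P_b P_F1 that matrix_mul_assoc)
  also have "\<dots> = mscale (- q l) (P l)"
    by (simp add: q_eq mat_vs.scale_left_distrib mat_vs.scale_left_diff_distrib)
  finally show "P l ** (c ** d) = mscale (- q l) (P l)" .
qed

text \<open>Because \<open>c\<close> is the negative adjoint of \<open>d\<close>, the product of
  \<open>d ** P l\<close> with its own adjoint contains \<open>c ** (d ** P l)\<close>, which is 0
  when \<open>q l = 0\<close>.\<close>

lemma d_P_0: "d ** P l = 0" and P_c_0: "P l ** c = 0" if "l \<in> {\<alpha>, \<beta>}"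
proof -
  have l: "l \<noteq> 0" "q l = 0"
    using that \<alpha>\<beta>_nonzero by (auto simp: q_def)
  have "adjoint_matrix (d ** P l) ** (d ** P l) = - (adjoint_matrix (P l) ** (c ** (d ** P l)))"
    by (simp add: adjoint_matrix_mult abcd_adjoint adjoint_matrix_minus matrix_algebra)
  then show "d ** P l = 0"
    using l by (simp add: cd_P adjoint_mult_eq_0_iff)
  \<comment> \<open>The same positivity argument from the other side, for the adjoint of
    \<open>P l ** c\<close>.\<close>
  have "adjoint_matrix (adjoint_matrix (P l ** c)) ** adjoint_matrix (P l ** c) =
      - ((P l ** (c ** d)) ** adjoint_matrix (P l))"
    by (simp add: adjoint_matrix_mult abcd_adjoint adjoint_matrix_minus matrix_algebra)
  also have "\<dots> = 0"
    unfolding P_cd[OF l(1)] l(2) by simp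
  finally have "adjoint_matrix (P l ** c) = 0"
    by (simp only: adjoint_mult_eq_0_iff)
  then have "adjoint_matrix (adjoint_matrix (P l ** c)) = 0"
    by simp
  then show "P l ** c = 0"
    by simp
qed

definition \<Lambda>2 :: "complex set" where
  "\<Lambda>2 = \<Lambda> - {0, \<alpha>, \<beta>}"

lemma \<Lambda>2: "l \<in> \<Lambda>2 \<Longrightarrow> l \<noteq> 0" "l \<in> \<Lambda>2 \<Longrightarrow> q l \<noteq> 0"
  and finite_\<Lambda>2: "finite \<Lambda>2"
  by (auto simp: \<Lambda>2_def q_def finite_\<Lambda>)

lemma F1_sum': "F1 = (\<Sum>l\<in>\<Lambda>2. P l) + P \<alpha> + P \<beta>"
proof -
  have "F1 = (\<Sum>l\<in>\<Lambda>2 \<union> {\<alpha>, \<beta>}. P l)"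
    unfolding F1_sum using finite_\<Lambda> P_nonzero \<alpha>\<beta>_nonzero
    by (intro sum.mono_neutral_left) (auto simp: \<Lambda>2_def)
  also have "\<dots> = (\<Sum>l\<in>\<Lambda>2. P l) + (\<Sum>l\<in>{\<alpha>, \<beta>}. P l)"
    using finite_\<Lambda> by (intro sum.union_disjoint) (auto simp: \<Lambda>2_def)
  finally show ?thesis
    using \<alpha>\<beta>(1) by (simp add: add.assoc)
qed

text \<open>\<open>G l\<close> is the copy of \<open>P l\<close> on the side of \<open>F2\<close>, and \<open>R2\<close> projects onto what these copies leave
  over. There \<open>(e - \<alpha>) (e - \<beta>) = 0\<close>, and \<open>Q \<alpha>\<close>, \<open>Q \<beta>\<close> are the corresponding spectral projections.\<close>

definition G :: "complex \<Rightarrow> complex^'n^'n" where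
  "G l = mscale (- inverse (q l)) (d ** (P l ** c))"

definition R2 :: "complex^'n^'n" where
  "R2 = F2 - (\<Sum>l\<in>\<Lambda>2. G l)"

lemma F2_G: "F2 ** G l = G l" and G_F2: "G l ** F2 = G l"
  by (simp_all add: G_def matrix_algebra)

text \<open>For \<open>l\<close> in \<open>\<Lambda>2\<close> the product \<open>c ** G l\<close> is
  \<open>P l ** c\<close>. Summation recovers \<open>F1 ** c\<close> up to the terms at \<alpha> and
  \<beta>, which vanish by \<open>P_c_0\<close>.\<close>

lemma c_R2: "c ** R2 = 0"
proof -
  have "c ** G l = P l ** c" if "l \<in> \<Lambda>2" for l
  proof -
    have "c ** G l = mscale (- inverse (q l)) ((c ** (d ** P l)) ** c)"
      by (simp add: G_def matrix_algebra)
    then show ?thesis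
      using \<Lambda>2[of l] that by (simp add: cd_P matrix_algebra)
  qed
  then have "c ** R2 = c - (\<Sum>l\<in>\<Lambda>2. P l ** c)"
    by (simp add: R2_def matrix_diff_ldistrib matrix_sum_ldistrib)
  also have "\<dots> = F1 ** c - (\<Sum>l\<in>\<Lambda>2. P l) ** c"
    by (simp add: matrix_sum_rdistrib)
  also have "\<dots> = P \<alpha> ** c + P \<beta> ** c"
    unfolding F1_sum' by (simp add: matrix_mult_add_left)
  finally show ?thesis
    by (simp add: P_c_0)
qed

lemma R2_d: "R2 ** d = 0"
proof -
  have "G l ** d = d ** P l" if "l \<in> \<Lambda>2" for l
  proof -
    have "G l ** d = mscale (- inverse (q l)) (d ** (P l ** (c ** d)))"
      by (simp add: G_def matrix_algebra)
    then show ?thesis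
      using \<Lambda>2[of l] that by (simp add: P_cd matrix_algebra)
  qed
  then have "R2 ** d = d - (\<Sum>l\<in>\<Lambda>2. d ** P l)"
    by (simp add: R2_def matrix_diff_rdistrib matrix_sum_rdistrib)
  also have "\<dots> = d ** F1 - d ** (\<Sum>l\<in>\<Lambda>2. P l)"
    by (simp add: matrix_sum_ldistrib)
  also have "\<dots> = d ** P \<alpha> + d ** P \<beta>"
    unfolding F1_sum' by (simp add: matrix_add_ldistrib)
  finally show ?thesis
    by (simp add: d_P_0)
qed

lemma F2_R2: "F2 ** R2 = R2" and R2_F2: "R2 ** F2 = R2"
  by (simp_all add: R2_def matrix_algebra F_mult F2_G G_F2)

lemma G_absorb:
  assumes "c ** X = 0" shows "G l ** X = 0"
  using assms by (simp add: G_def matrix_algebra)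

text \<open>Together with \<open>c_R2\<close> this identifies \<open>R2\<close> as a projection onto
  the kernel of \<open>c\<close> in \<open>V\<^sub>2\<close>.\<close>

lemma R2_absorb:
  assumes "c ** X = 0" "F2 ** X = X" shows "R2 ** X = X"
  using assms by (simp add: R2_def matrix_algebra G_absorb)

lemma R2_idem: "R2 ** R2 = R2"
  by (rule R2_absorb[OF c_R2 F2_R2])

text \<open>The intertwining relations for \<open>c\<close> and \<open>d\<close> carry the
  eigenvalue \<open>l\<close> of \<open>b\<close> to the eigenvalue \<open>- 1 - l\<close> of
  \<open>e\<close>.\<close>

lemma e_G: "e ** G l = mscale (- 1 - l) (G l)" "G l ** e = mscale (- 1 - l) (G l)"
proof -
  have ed: "e ** d = - (d ** b) - d" and ce: "c ** e = - (b ** c) - c"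
    using relations(2,3) by (simp_all add: algebra_simps eq_neg_iff_add_eq_0)
  have "e ** (d ** (P l ** c)) = (e ** d) ** (P l ** c)"
    by (rule matrix_mul_assoc)
  also have "\<dots> = - (d ** ((b ** P l) ** c)) - d ** (P l ** c)"
    unfolding ed by (simp add: matrix_algebra)
  also have "\<dots> = mscale (- 1 - l) (d ** (P l ** c))"
    by (simp add: b_P matrix_algebra mat_vs.scale_left_diff_distrib)
  finally show "e ** G l = mscale (- 1 - l) (G l)"
    by (simp add: G_def matrix_algebra mult.commute)
  have "d ** (P l ** (c ** e)) = - (d ** ((P l ** b) ** c)) - d ** (P l ** c)"
    unfolding ce by (simp add: matrix_algebra)
  also have "\<dots> = mscale (- 1 - l) (d ** (P l ** c))"
    by (simp add: P_b matrix_algebra mat_vs.scale_left_diff_distrib)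
  finally show "G l ** e = mscale (- 1 - l) (G l)"
    by (simp add: G_def matrix_algebra mult.commute)
qed

lemma e_R2_commute: "e ** R2 = R2 ** e"
  by (simp add: R2_def matrix_algebra e_G)

section \<open>Spectral projections of \<open>e\<close> on the range of \<open>R2\<close>\<close>

definition comb :: "complex \<Rightarrow> complex \<Rightarrow> complex^'n^'n" where
  "comb s t = mscale s (e ** R2) + mscale t R2"

lemma e_e_R2: "e ** (e ** R2) = - (e ** R2) - mscale (of_nat (u + 1)) R2"
proof -
  have "0 = (d ** c + e ** e + e + mscale (of_nat (u + 1)) F2) ** R2"
    by (simp only: relations(4) matrix_mult_0)
  also have "\<dots> = e ** (e ** R2) + e ** R2 + mscale (of_nat (u + 1)) R2"
    by (simp add: matrix_algebra c_R2 F2_R2)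
  finally show ?thesis
    by (simp add: algebra_simps eq_neg_iff_add_eq_0)
qed

lemma R2_e: "R2 ** (e ** R2) = e ** R2"
  using e_R2_commute R2_idem by (metis matrix_mul_assoc)

text \<open>Multiplication in the span of \<open>e ** R2\<close> and \<open>R2\<close>, reduced by
  the quadratic equation that \<open>e\<close> satisfies there.\<close>

lemma comb_mult:
  "comb s t ** comb s' t' = comb (s * t' + s' * t - s * s') (t * t' - of_nat (u + 1) * (s * s'))"
proof -
  have "(e ** R2) ** (e ** R2) = - (e ** R2) - mscale (of_nat (u + 1)) R2"
    by (simp add: R2_e e_e_R2 flip: matrix_mul_assoc)
  then show ?thesis
    by (simp add: comb_def matrix_algebra R2_e R2_idem e_e_R2 mat_vs.scale_left_distrib
        mat_vs.scale_left_diff_distrib algebra_simps)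
qed

lemma e_comb: "e ** comb s t = comb (t - s) (- of_nat (u + 1) * s)"
  by (simp add: comb_def matrix_algebra e_e_R2 mat_vs.scale_left_distrib
        mat_vs.scale_left_diff_distrib algebra_simps)

lemma comb_add: "comb s t + comb s' t' = comb (s + s') (t + t')"
  and mscale_comb: "mscale a (comb s t) = comb (a * s) (a * t)"
  and comb_0: "comb 0 0 = 0"
  by (simp_all add: comb_def matrix_algebra mat_vs.scale_left_distrib)

text \<open>These are \<open>(e - \<beta>) / (\<alpha> - \<beta>)\<close> and
  \<open>(e - \<alpha>) / (\<beta> - \<alpha>)\<close> on the range of \<open>R2\<close>; the value
  0 elsewhere follows the convention for \<open>P\<close>.\<close>

definition Q :: "complex \<Rightarrow> complex^'n^'n" where
  "Q l = (if l = \<alpha> then comb (inverse (\<alpha> - \<beta>)) (- \<beta> * inverse (\<alpha> - \<beta>))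
          else if l = \<beta> then comb (inverse (\<beta> - \<alpha>)) (- \<alpha> * inverse (\<beta> - \<alpha>)) else 0)"

lemma Q_sum: "Q \<alpha> + Q \<beta> = R2"
proof -
  have i: "inverse (\<beta> - \<alpha>) = - inverse (\<alpha> - \<beta>)"
    by (metis inverse_minus_eq minus_diff_eq)
  have "inverse (\<alpha> - \<beta>) + inverse (\<beta> - \<alpha>) = 0"
    "- \<beta> * inverse (\<alpha> - \<beta>) + - \<alpha> * inverse (\<beta> - \<alpha>) = (\<alpha> - \<beta>) * inverse (\<alpha> - \<beta>)"
    unfolding i by (simp_all add: algebra_simps)
  moreover have "(\<alpha> - \<beta>) * inverse (\<alpha> - \<beta>) = 1"
    using \<alpha>\<beta>(1) by simp
  ultimately have "Q \<alpha> + Q \<beta> = comb 0 1"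
    using \<alpha>\<beta>(1) by (simp add: Q_def comb_add)
  then show ?thesis
    by (simp add: comb_def)
qed

text \<open>Stated for general \<open>r\<close> and \<open>s\<close>, so that both orders of
  \<alpha> and \<beta> are instances.\<close>

lemma comb_idem:
  assumes "r \<noteq> s" "r + s = - 1" "r * s = of_nat (u + 1)"
  shows "comb (inverse (r - s)) (- s * inverse (r - s)) ** comb (inverse (r - s)) (- s * inverse (r - s)) =
      comb (inverse (r - s)) (- s * inverse (r - s))"
    and "comb (inverse (r - s)) (- s * inverse (r - s)) ** comb (inverse (s - r)) (- r * inverse (s - r)) = 0"
    and "e ** comb (inverse (r - s)) (- s * inverse (r - s)) =
      mscale r (comb (inverse (r - s)) (- s * inverse (r - s)))"
proof -
  define i where "i = inverse (r - s)"
  have i: "i * (r - s) = 1"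
    using assms by (simp add: i_def)
  have i': "inverse (s - r) = - i"
    unfolding i_def by (metis inverse_minus_eq minus_diff_eq)
  \<comment> \<open>\<open>1\<close> and \<open>2\<close> are the coefficients of the square, and
    \<open>3\<close> is the first coefficient of the mixed product, as computed by
    \<open>comb_mult\<close>.\<close>
  have 1: "i * (- s * i) + i * (- s * i) - i * i = i"
  proof -
    have "i * (- s * i) + i * (- s * i) - i * i = i * i * (- 1 - 2 * s)"
      by (simp add: algebra_simps)
    also have "\<dots> = i * (i * (r - s))"
      unfolding assms(2)[symmetric] by (simp add: algebra_simps)
    finally show ?thesis
      by (simp add: i)
  qed
  have 2: "- s * i * (- s * i) - r * s * (i * i) = - s * i"
  proof -
    have "- s * i * (- s * i) - r * s * (i * i) = - s * i * (i * (r - s))"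
      by (simp add: algebra_simps)
    then show ?thesis
      by (simp add: i)
  qed
  have 3: "i * (- r * - i) + - i * (- s * i) - i * - i = 0"
  proof -
    have "i * (- r * - i) + - i * (- s * i) - i * - i = i * i * (r + s + 1)"
      by (simp add: algebra_simps)
    then show ?thesis
      by (simp add: assms(2))
  qed
  show "comb (inverse (r - s)) (- s * inverse (r - s)) ** comb (inverse (r - s)) (- s * inverse (r - s)) =
      comb (inverse (r - s)) (- s * inverse (r - s))"
    unfolding comb_mult assms(3)[symmetric] i_def[symmetric] 1 2 ..
  show "comb (inverse (r - s)) (- s * inverse (r - s)) ** comb (inverse (s - r)) (- r * inverse (s - r)) = 0"
    unfolding comb_mult assms(3)[symmetric] i' i_def[symmetric] 3
    by (simp add: comb_0)
  have "- s * i - i = r * i"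
  proof -
    have "- s * i - i = (- 1 - s) * i"
      by (simp add: algebra_simps)
    then show ?thesis
      unfolding assms(2)[symmetric] by simp
  qed
  then show "e ** comb (inverse (r - s)) (- s * inverse (r - s)) =
      mscale r (comb (inverse (r - s)) (- s * inverse (r - s)))"
    unfolding e_comb mscale_comb assms(3)[symmetric] i_def[symmetric] by (simp add: mult.assoc)
qed

lemma Q_mult: "Q l ** Q m = (if l = m then Q l else 0)"
  using comb_idem[OF \<alpha>\<beta>] comb_idem[of \<beta> \<alpha>] \<alpha>\<beta>
  by (auto simp: Q_def add.commute mult.commute)

lemma e_Q: "e ** Q l = mscale l (Q l)"
  using comb_idem(3)[OF \<alpha>\<beta>] comb_idem(3)[of \<beta> \<alpha>] \<alpha>\<beta>
  by (auto simp: Q_def add.commute mult.commute)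

text \<open>By cyclicity of the trace, \<open>d ** P l ** c\<close> may be replaced by
  \<open>P l ** c ** d\<close>, whose factor \<open>- q l\<close> cancels the normalisation of
  \<open>G l\<close>.\<close>

lemma trace_G: "trace (G l) = trace (P l)" if "l \<in> \<Lambda>2"
proof -
  have "trace (d ** (P l ** c)) = trace ((P l ** c) ** d)"
    by (rule trace_mul_sym)
  also have "(P l ** c) ** d = P l ** (c ** d)"
    by (rule matrix_mul_assoc[symmetric])
  also have "trace \<dots> = - q l * trace (P l)"
    by (simp only: P_cd[OF \<Lambda>2(1)[OF that]] trace_mscale)
  finally show ?thesis
    using \<Lambda>2[OF that] by (simp add: G_def trace_mscale del: mat_vs.scale_minus_left)
qed

lemma trace_P_sum: "of_nat (2 * u) = (\<Sum>l\<in>\<Lambda>2. trace (P l)) + trace (P \<alpha>) + trace (P \<beta>)"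
  using arg_cong[OF F1_sum', of trace] by (simp add: F_trace trace_add trace_sum)

text \<open>\<open>F1\<close> and \<open>F2\<close> have the same trace, and so do their parts
  belonging to \<open>\<Lambda>2\<close>; hence so do the parts left over.\<close>

lemma trace_Q_sum: "trace (Q \<alpha>) + trace (Q \<beta>) = trace (P \<alpha>) + trace (P \<beta>)"
proof -
  have "trace (Q \<alpha>) + trace (Q \<beta>) = trace F2 - (\<Sum>l\<in>\<Lambda>2. trace (G l))"
    by (simp add: Q_sum R2_def trace_sub trace_sum flip: trace_add)
  then show ?thesis
    using trace_P_sum by (simp add: F_trace trace_G)
qed

text \<open>As \<open>transpose b = - F1 - b\<close>, transposition turns an eigenprojection for
  \<open>l\<close> into one for \<open>- 1 - l\<close>. Two uses of \<open>absorb\<close> show that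
  \<open>transpose (P l)\<close> and \<open>P m\<close> both equal
  \<open>transpose (P l) ** P m\<close>.\<close>

lemma P_transpose:
  assumes "l \<noteq> 0" "m \<noteq> 0" "l + m = - 1"
  shows "transpose (P l) = P m"
proof -
  have absorb: "transpose (P l) ** P m = transpose (P l)"
    if lm: "l \<noteq> 0" "l + m = - 1" for l m
  proof -
    have F1: "transpose (P l) ** F1 = transpose (P l)"
      using F1_P[OF lm(1)] by (metis F_transpose(1) matrix_transpose_mul)
    have "transpose (P l) ** (- F1 - b) = mscale l (transpose (P l))"
      using b_P[of l] by (metis abcd_transpose(1) matrix_transpose_mul transpose_mscale)
    then have "transpose (P l) ** b = mscale (- 1 - l) (transpose (P l))"
      by (simp add: matrix_algebra F1 mat_vs.scale_left_diff_distrib algebra_simps)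
    then have *: "transpose (P l) ** b = mscale m (transpose (P l))"
      using lm(2) by (metis add_diff_cancel_left' )
    have zero: "transpose (P l) ** P k = 0" if "k \<noteq> m" for k
    proof -
      have "mscale k (transpose (P l) ** P k) = transpose (P l) ** (b ** P k)"
        by (simp add: b_P mscale_mult_right)
      also have "\<dots> = mscale m (transpose (P l) ** P k)"
        by (simp add: matrix_mul_assoc * mscale_mult_left)
      finally show ?thesis
        using that by simp
    qed
    have "transpose (P l) = transpose (P l) ** (\<Sum>k\<in>\<Lambda>. P k)"
      by (simp add: P_sum)
    also have "\<dots> = (\<Sum>k\<in>\<Lambda>. if k = m then transpose (P l) ** P m else 0)"
      unfolding matrix_sum_ldistrib by (intro sum.cong) (auto simp: zero)
    also have "\<dots> = transpose (P l) ** P m"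
      using finite_\<Lambda> P_nonzero[of m] by auto
    finally show ?thesis ..
  qed
  have "P m = transpose (transpose (P m) ** P l)"
    using absorb[of m l] assms by (simp add: add.commute)
  also have "\<dots> = transpose (P l) ** P m"
    by (simp add: matrix_transpose_mul)
  finally show ?thesis
    using absorb[of l m] assms by simp
qed

text \<open>Transposing \<open>R2 ** d = 0\<close> places \<open>transpose R2\<close> in the kernel
  of \<open>c\<close>. So \<open>R2_absorb\<close> gives
  \<open>R2 ** transpose R2 = transpose R2\<close>, whose left side is symmetric.\<close>

lemma R2_transpose: "transpose R2 = R2"
proof -
  have "c ** transpose R2 = transpose (R2 ** transpose c)"
    by (simp add: matrix_transpose_mul)
  also have "\<dots> = 0"
    by (simp add: abcd_transpose matrix_algebra R2_d) (simp add: transpose_def vec_eq_iff)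
  finally have "c ** transpose R2 = 0" .
  moreover have "F2 ** transpose R2 = transpose R2"
    using R2_F2 by (metis F_transpose(2) matrix_transpose_mul)
  ultimately have "R2 ** transpose R2 = transpose R2"
    by (rule R2_absorb)
  then show ?thesis
    by (metis matrix_transpose_mul transpose_transpose)
qed

lemma Q_transpose: "transpose (Q \<alpha>) = Q \<beta>"
proof -
  have "transpose (e ** R2) = - R2 - e ** R2"
    by (simp add: matrix_transpose_mul R2_transpose abcd_transpose matrix_algebra R2_F2 F2_R2 e_R2_commute)
  then have "transpose (comb s t) = comb (- s) (t - s)" for s t
    by (simp add: comb_def transpose_add transpose_mscale R2_transpose matrix_algebra
        mat_vs.scale_left_diff_distrib)
  moreover have i: "inverse (\<beta> - \<alpha>) = - inverse (\<alpha> - \<beta>)"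
    by (metis inverse_minus_eq minus_diff_eq)
  moreover have "- \<beta> * inverse (\<alpha> - \<beta>) - inverse (\<alpha> - \<beta>) = (- 1 - \<beta>) * inverse (\<alpha> - \<beta>)"
    by (simp add: algebra_simps)
  moreover have "- 1 - \<beta> = \<alpha>"
    unfolding \<alpha>\<beta>(2)[symmetric] by simp
  ultimately show ?thesis
    using \<alpha>\<beta>(1) by (simp add: Q_def)
qed

text \<open>Transposition exchanges the projections at \<alpha> and \<beta> on each side, and the
  two sides have equal sums.\<close>

lemma trace_equal:
  "trace (P \<beta>) = trace (P \<alpha>)" "trace (Q \<alpha>) = trace (P \<alpha>)" "trace (Q \<beta>) = trace (P \<alpha>)"
proof -
  show P: "trace (P \<beta>) = trace (P \<alpha>)"
    using P_transpose[OF \<alpha>\<beta>_nonzero \<alpha>\<beta>(2)] by (metis trace_transpose)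
  have Q: "trace (Q \<beta>) = trace (Q \<alpha>)"
    using Q_transpose by (metis trace_transpose)
  show Q\<alpha>: "trace (Q \<alpha>) = trace (P \<alpha>)"
    using trace_Q_sum unfolding P Q by simp
  show "trace (Q \<beta>) = trace (P \<alpha>)"
    using Q Q\<alpha> by simp
qed

lemma nonzero_iff:
  "P \<beta> \<noteq> 0 \<longleftrightarrow> P \<alpha> \<noteq> 0" "Q \<alpha> \<noteq> 0 \<longleftrightarrow> P \<alpha> \<noteq> 0" "Q \<beta> \<noteq> 0 \<longleftrightarrow> P \<alpha> \<noteq> 0"
  using trace_equal idempotent_eq_0_iff[of "P \<alpha>"] idempotent_eq_0_iff[of "P \<beta>"]
    idempotent_eq_0_iff[of "Q \<alpha>"] idempotent_eq_0_iff[of "Q \<beta>"]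
  by (simp_all add: P_mult Q_mult)

text \<open>The ranks of the projections composing \<open>F1\<close> add up to \<open>2 * u\<close>.
  Each \<open>l\<close> in \<open>\<Lambda>2\<close> contributes at least 1, and \<alpha> and
  \<beta> contribute equally.\<close>

lemma card_\<Lambda>2: "card \<Lambda>2 + 2 * vec.dim (range ((*v) (P \<alpha>))) \<le> 2 * u"
proof -
  let ?r = "\<lambda>l. vec.dim (range ((*v) (P l)))"
  have tr: "trace (P l) = of_nat (?r l)" for l
    by (rule trace_idempotent) (simp add: P_mult)
  have "1 \<le> ?r l" if "l \<in> \<Lambda>2" for l
  proof -
    have "P l \<noteq> 0"
      using that P_nonzero[of l] by (simp add: \<Lambda>2_def)
    then have "trace (P l) \<noteq> 0"
      using idempotent_eq_0_iff[of "P l"] by (simp add: P_mult)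
    then show ?thesis
      unfolding tr of_nat_eq_0_iff by linarith
  qed
  then have "card \<Lambda>2 \<le> (\<Sum>l\<in>\<Lambda>2. ?r l)"
    using sum_mono[of \<Lambda>2 "\<lambda>_. 1" ?r] by simp
  moreover have "complex_of_nat (2 * u) = of_nat ((\<Sum>l\<in>\<Lambda>2. ?r l) + 2 * ?r \<alpha>)"
    using trace_P_sum unfolding trace_equal(1) unfolding tr by simp
  then have "2 * u = (\<Sum>l\<in>\<Lambda>2. ?r l) + 2 * ?r \<alpha>"
    unfolding of_nat_eq_iff .
  ultimately show ?thesis
    by linarith
qed

end

section \<open>Matrix units of the Terwilliger algebra\<close>

text \<open>\<open>Double l\<close> belongs to the eigenvalue \<open>l\<close> of \<open>b\<close>. \<open>Out l\<close> and \<open>In l\<close> are the one-dimensional blocks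
  supported on the out- and on the in-neighbourhood of \<open>x\<close>.\<close>

datatype block = Primary | Double complex | Out complex | In complex

text \<open>\<open>U\<close> supplies the units of the three-dimensional primary block.
  \<open>U_sandwich\<close> expresses that the diagonal units have rank one.\<close>

locale corner_units = corner_spectral F1 F2 A u \<alpha> \<beta> \<Lambda> P
  for F1 F2 A :: "complex^'n::finite^'n" and u \<alpha> \<beta> \<Lambda> P +
  fixes U :: "nat \<Rightarrow> nat \<Rightarrow> complex^'n^'n"
  assumes U_mult: "\<lbrakk>i < 3; j < 3; k < 3; l < 3\<rbrakk> \<Longrightarrow> U i j ** U k l = (if j = k then U i l else 0)"
    and U_nonzero: "U 0 0 \<noteq> 0"
    and U_F: "\<lbrakk>i < 3; j < 3\<rbrakk> \<Longrightarrow> U i j ** F1 = 0" "\<lbrakk>i < 3; j < 3\<rbrakk> \<Longrightarrow> U i j ** F2 = 0"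
    and F_U: "\<lbrakk>i < 3; j < 3\<rbrakk> \<Longrightarrow> F1 ** U i j = 0" "\<lbrakk>i < 3; j < 3\<rbrakk> \<Longrightarrow> F2 ** U i j = 0"
    and U_sum: "(\<Sum>i<3. U i i) + F1 + F2 = mat 1"
    and U_sandwich: "\<lbrakk>i < 3; j < 3\<rbrakk> \<Longrightarrow> \<exists>s. U i i ** (M ** U j j) = mscale s (U i j)"
begin

definition blocks :: "block set" where
  "blocks = {Primary} \<union> Double ` \<Lambda>2 \<union> Out ` {l \<in> {\<alpha>, \<beta>}. P l \<noteq> 0} \<union> In ` {l \<in> {\<alpha>, \<beta>}. Q l \<noteq> 0}"

fun sz :: "block \<Rightarrow> nat" where
  "sz Primary = 3"
| "sz (Double l) = 2"
| "sz (Out l) = 1"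
| "sz (In l) = 1"

fun mid :: "block \<Rightarrow> complex^'n^'n" where
  "mid Primary = U 0 0"
| "mid (Double l) = P l"
| "mid (Out l) = P l"
| "mid (In l) = Q l"

fun lft :: "block \<Rightarrow> nat \<Rightarrow> complex^'n^'n" where
  "lft Primary i = U i 0"
| "lft (Double l) i = (if i = 0 then P l else d ** P l)"
| "lft (Out l) i = P l"
| "lft (In l) i = Q l"

text \<open>The factor \<open>- inverse (q l)\<close> compensates for
  \<open>c ** (d ** P l) = mscale (- q l) (P l)\<close>, so that the right factor 1 times the left
  factor 1 of \<open>Double l\<close> is \<open>P l\<close>.\<close>

fun rgt :: "block \<Rightarrow> nat \<Rightarrow> complex^'n^'n" where
  "rgt Primary j = U 0 j"
| "rgt (Double l) j = (if j = 0 then P l else mscale (- inverse (q l)) (P l ** c))"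
| "rgt (Out l) j = P l"
| "rgt (In l) j = Q l"

text \<open>The unit \<open>(i, j)\<close> of a block factors through the idempotent \<open>mid\<close>, so that the multiplication table
  only requires the products of a right factor with a left factor.\<close>

definition unit :: "block \<Rightarrow> nat \<Rightarrow> nat \<Rightarrow> complex^'n^'n" where
  "unit r i j = lft r i ** rgt r j"

lemma zero_products:
  assumes "i < 3" "j < 3"
  shows "l \<noteq> 0 \<Longrightarrow> U i j ** P l = 0" "l \<noteq> 0 \<Longrightarrow> P l ** U i j = 0"
    and "U i j ** d = 0" "c ** U i j = 0" "U i j ** R2 = 0" "R2 ** U i j = 0"
  using matrix_mult_zero_right[OF U_F(1)[OF assms] F1_P] matrix_mult_zero_left[OF F_U(1)[OF assms] P_F1]
    matrix_mult_zero_right[OF U_F(2)[OF assms] F_abcd(7)] matrix_mult_zero_left[OF F_U(2)[OF assms] F_abcd(14)]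
    matrix_mult_zero_right[OF U_F(2)[OF assms] F2_R2] matrix_mult_zero_left[OF F_U(2)[OF assms] R2_F2]
  by auto

lemma Q_R2: "Q l ** R2 = Q l" "R2 ** Q l = Q l"
proof -
  have "comb s t ** R2 = comb s t" "R2 ** comb s t = comb s t" for s t
    by (simp_all add: comb_def matrix_algebra R2_idem R2_e)
  then show "Q l ** R2 = Q l" "R2 ** Q l = Q l"
    by (auto simp: Q_def)
qed

lemma Q_products:
  "c ** Q l = 0" "Q l ** d = 0" "l \<noteq> 0 \<Longrightarrow> P l ** Q m = 0" "l \<noteq> 0 \<Longrightarrow> Q m ** P l = 0"
  "\<lbrakk>i < 3; j < 3\<rbrakk> \<Longrightarrow> U i j ** Q l = 0" "\<lbrakk>i < 3; j < 3\<rbrakk> \<Longrightarrow> Q l ** U i j = 0"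
proof -
  show "c ** Q l = 0" "Q l ** d = 0"
    using matrix_mult_zero_right[OF c_R2 Q_R2(2)] matrix_mult_zero_left[OF R2_d Q_R2(1)] .
  have "F1 ** R2 = 0" "R2 ** F1 = 0"
    using matrix_mult_zero_right[OF F_mult(3) F2_R2] matrix_mult_zero_left[OF F_mult(4) R2_F2] .
  then have "F1 ** Q m = 0" "Q m ** F1 = 0"
    using matrix_mult_zero_right[OF _ Q_R2(2)] matrix_mult_zero_left[OF _ Q_R2(1)] by blast+
  then show "P l ** Q m = 0" "Q m ** P l = 0" if "l \<noteq> 0"
    using matrix_mult_zero_left[OF _ P_F1[OF that]] matrix_mult_zero_right[OF _ F1_P[OF that]] by blast+
  show "U i j ** Q l = 0" "Q l ** U i j = 0" if "i < 3" "j < 3"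
    using matrix_mult_zero_right[OF zero_products(5)[OF that] Q_R2(2)]
      matrix_mult_zero_left[OF zero_products(6)[OF that] Q_R2(1)] .
qed

lemma P_d: "l \<noteq> 0 \<Longrightarrow> P l ** d = 0" and c_P: "l \<noteq> 0 \<Longrightarrow> c ** P l = 0"
  using matrix_mult_zero_left[OF F_abcd(3) P_F1] matrix_mult_zero_right[OF F_abcd(10) F1_P] by auto

lemmas unit_simps = P_mult Q_mult U_mult zero_products Q_products P_d c_P cd_P matrix_algebra
  zero_products[THEN matrix_mult_eq_assoc] Q_products[THEN matrix_mult_eq_assoc]
  P_d[THEN matrix_mult_eq_assoc] c_P[THEN matrix_mult_eq_assoc]

lemma in_blocks:
  "Primary \<in> blocks" "Double l \<in> blocks \<longleftrightarrow> l \<in> \<Lambda>2"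
  "Out l \<in> blocks \<longleftrightarrow> l \<in> {\<alpha>, \<beta>} \<and> P l \<noteq> 0" "In l \<in> blocks \<longleftrightarrow> l \<in> {\<alpha>, \<beta>} \<and> Q l \<noteq> 0"
  by (auto simp: blocks_def)

lemma Double_neq: "l \<in> \<Lambda>2 \<Longrightarrow> l \<noteq> 0 \<and> q l \<noteq> 0 \<and> l \<noteq> \<alpha> \<and> l \<noteq> \<beta>"
  using \<Lambda>2[of l] by (auto simp: \<Lambda>2_def)

lemma rgt_lft:
  assumes "r \<in> blocks" "s \<in> blocks" "i < sz r" "j < sz s"
  shows "rgt r i ** lft s j = (if r = s \<and> i = j then mid r else 0)"
  using assms \<alpha>\<beta>_nonzero
  by (cases r; cases s) (auto simp: in_blocks unit_simps dest!: Double_neq)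

lemma lft_mid:
  assumes "r \<in> blocks" "i < sz r"
  shows "lft r i ** mid r = lft r i"
  using assms by (cases r) (auto simp: unit_simps)

lemma sum_blocks:
  fixes f :: "block \<Rightarrow> 'a::comm_monoid_add"
  shows "(\<Sum>r\<in>blocks. f r) = f Primary + (\<Sum>l\<in>\<Lambda>2. f (Double l))
    + (\<Sum>l\<in>{l \<in> {\<alpha>, \<beta>}. P l \<noteq> 0}. f (Out l)) + (\<Sum>l\<in>{l \<in> {\<alpha>, \<beta>}. Q l \<noteq> 0}. f (In l))"
proof -
  have "(\<Sum>r\<in>blocks. f r) = (\<Sum>r\<in>{Primary}. f r) + (\<Sum>r\<in>Double ` \<Lambda>2. f r)
    + (\<Sum>r\<in>Out ` {l \<in> {\<alpha>, \<beta>}. P l \<noteq> 0}. f r) + (\<Sum>r\<in>In ` {l \<in> {\<alpha>, \<beta>}. Q l \<noteq> 0}. f r)"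
    unfolding blocks_def using finite_\<Lambda>2
    by (subst sum.union_disjoint; (subst sum.union_disjoint)?; (subst sum.union_disjoint)?) auto
  then show ?thesis
    by (simp add: sum.reindex inj_on_def)
qed

lemma sum_pair: "(\<Sum>l\<in>{l \<in> {\<alpha>, \<beta>}. X l \<noteq> 0}. X l) = X \<alpha> + X \<beta>" for X :: "complex \<Rightarrow> complex^'n^'n"
proof -
  have "(\<Sum>l\<in>{l \<in> {\<alpha>, \<beta>}. X l \<noteq> 0}. X l) = (\<Sum>l\<in>{\<alpha>, \<beta>}. X l)"
    by (intro sum.mono_neutral_left) auto
  then show ?thesis
    using \<alpha>\<beta>(1) by simp
qed

lemma finite_blocks: "finite blocks"
  by (simp add: blocks_def finite_\<Lambda>2)

lemma unit_sum: "(\<Sum>r\<in>blocks. \<Sum>i<sz r. unit r i i) = mat 1"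
proof -
  \<comment> \<open>The two diagonal units are the projection \<open>P l\<close> on
    \<open>V\<^sub>1\<close> and its copy \<open>G l\<close> on \<open>V\<^sub>2\<close>.\<close>
  have "(\<Sum>i<sz (Double l). unit (Double l) i i) = P l + G l" if "l \<in> \<Lambda>2" for l
    by (simp add: unit_def numeral_2_eq_2 G_def P_mult matrix_algebra P_mult[THEN matrix_mult_eq_assoc])
  moreover have "(\<Sum>i<sz Primary. unit Primary i i) = (\<Sum>i<3. U i i)"
    by (simp add: unit_def U_mult)
  moreover have "(\<Sum>i<sz (Out l). unit (Out l) i i) = P l" "(\<Sum>i<sz (In l). unit (In l) i i) = Q l" for l
    by (simp_all add: unit_def P_mult Q_mult)
  ultimately have "(\<Sum>r\<in>blocks. \<Sum>i<sz r. unit r i i) =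
      (\<Sum>i<3. U i i) + (\<Sum>l\<in>\<Lambda>2. P l + G l) + (P \<alpha> + P \<beta>) + (Q \<alpha> + Q \<beta>)"
    by (simp add: sum_blocks sum_pair[simplified] del: sz.simps)
  also have "\<dots> = (\<Sum>i<3. U i i) + F1 + F2"
  proof -
    have "P \<alpha> + P \<beta> = F1 - (\<Sum>l\<in>\<Lambda>2. P l)"
      using F1_sum' by (simp add: algebra_simps)
    then show ?thesis
      unfolding Q_sum R2_def by (simp add: sum.distrib)
  qed
  finally show ?thesis
    by (simp add: U_sum)
qed

sublocale units: matrix_units blocks sz unit
proof
  show "unit r i j ** unit s k l = (if r = s \<and> j = k then unit r i l else 0)"
    if "r \<in> blocks" "s \<in> blocks" "i < sz r" "j < sz r" "k < sz s" "l < sz s" for r s i j k l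
  proof -
    have "unit r i j ** unit s k l = lft r i ** ((rgt r j ** lft s k) ** rgt s l)"
      by (simp add: unit_def matrix_mul_assoc)
    then show ?thesis
      using that by (auto simp: rgt_lft unit_def lft_mid matrix_mul_assoc)
  qed
  show "unit r 0 0 \<noteq> 0" if "r \<in> blocks" for r
    using that U_nonzero P_nonzero
    by (cases r) (auto simp: unit_def U_mult P_mult Q_mult in_blocks \<Lambda>2_def)
  show "0 < sz r" for r
    by (cases r) auto
qed (simp_all add: finite_blocks unit_sum)

section \<open>Comparison with subalgebras containing \<open>A\<close>\<close>

lemma U_in_alg: "i < 3 \<Longrightarrow> j < 3 \<Longrightarrow> U i j \<in> units.alg"
  using units.e_in_alg[of Primary i j] by (simp add: unit_def U_mult in_blocks)

lemmas alg_closed = matrix_subalgebra_closed[OF units.matrix_subalgebra_alg]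
  mat_vs.subspace_sum[OF units.subspace_alg]

lemma Q_in_alg: "Q l \<in> units.alg"
proof (cases "In l \<in> blocks")
  case True
  then show ?thesis
    using units.e_in_alg[of "In l" 0 0] by (simp add: unit_def Q_mult)
next
  case False
  then have "Q l = 0"
    by (auto simp: in_blocks Q_def)
  then show ?thesis
    by (simp add: alg_closed)
qed

lemma P_in_alg: "P l \<in> units.alg" if l: "l \<noteq> 0"
proof -
  consider "P l = 0" | "Double l \<in> blocks" | "Out l \<in> blocks"
    using l P_nonzero[of l] by (auto simp: in_blocks \<Lambda>2_def)
  then show ?thesis
  proof cases
    case 2
    then show ?thesis
      using units.e_in_alg[of "Double l" 0 0] by (simp add: unit_def P_mult)
  next
    case 3
    then show ?thesis
      using units.e_in_alg[of "Out l" 0 0] by (simp add: unit_def P_mult)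
  qed (simp add: alg_closed)
qed

lemma Double_in_alg:
  assumes "l \<in> \<Lambda>2"
  shows "d ** P l \<in> units.alg" "P l ** c \<in> units.alg" "G l \<in> units.alg"
proof -
  have q: "q l \<noteq> 0"
    using assms by (rule \<Lambda>2)
  have r: "Double l \<in> blocks"
    using assms by (simp add: in_blocks)
  show "d ** P l \<in> units.alg"
    using units.e_in_alg[OF r, of 1 0] by (simp add: unit_def matrix_algebra P_mult)
  have "mscale (- inverse (q l)) (P l ** c) \<in> units.alg"
    using units.e_in_alg[OF r, of 0 1]
    by (simp add: unit_def matrix_algebra P_mult P_mult[THEN matrix_mult_eq_assoc]
        del: mat_vs.scale_minus_left)
  then have "mscale (- q l) (mscale (- inverse (q l)) (P l ** c)) \<in> units.alg"
    by (rule alg_closed(5))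
  then show "P l ** c \<in> units.alg"
    using q by (simp del: mat_vs.scale_minus_left)
  show "G l \<in> units.alg"
    using units.e_in_alg[OF r, of 1 1]
    by (simp add: unit_def G_def matrix_algebra P_mult P_mult[THEN matrix_mult_eq_assoc])
qed

lemma F_in_alg: "F1 \<in> units.alg" "F2 \<in> units.alg"
proof -
  have "(\<Sum>l\<in>\<Lambda>-{0}. P l) \<in> units.alg"
    by (intro alg_closed P_in_alg) auto
  then show "F1 \<in> units.alg"
    by (simp only: F1_sum[symmetric])
  have "(\<Sum>l\<in>\<Lambda>2. G l) + (Q \<alpha> + Q \<beta>) \<in> units.alg"
    by (intro alg_closed Double_in_alg Q_in_alg)
  then show "F2 \<in> units.alg"
    by (simp add: Q_sum R2_def)
qed

text \<open>\<open>b\<close>, \<open>c\<close>, \<open>d\<close>, \<open>e\<close> are expanded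
  along the decompositions of \<open>F1\<close> and \<open>F2\<close> into projections. The rest of
  \<open>A\<close> is its compression to the primary module, a combination of the
  \<open>U i j\<close>.\<close>

lemma A_in_alg: "A \<in> units.alg"
proof -
  have "b = b ** F1"
    by simp
  also have "\<dots> = (\<Sum>l\<in>\<Lambda>-{0}. mscale l (P l))"
    by (subst F1_sum) (simp add: matrix_sum_ldistrib b_P)
  also have "\<dots> \<in> units.alg"
    by (intro alg_closed P_in_alg) auto
  finally have b: "b \<in> units.alg" .
  have "c = F1 ** c"
    by simp
  also have "\<dots> = (\<Sum>l\<in>\<Lambda>2. P l ** c)"
    by (subst F1_sum') (simp add: matrix_mult_add_left matrix_sum_rdistrib P_c_0)
  also have "\<dots> \<in> units.alg"
    by (intro alg_closed Double_in_alg)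
  finally have c: "c \<in> units.alg" .
  have "d = d ** F1"
    by simp
  also have "\<dots> = (\<Sum>l\<in>\<Lambda>2. d ** P l)"
    by (subst F1_sum') (simp add: matrix_add_ldistrib matrix_sum_ldistrib d_P_0)
  also have "\<dots> \<in> units.alg"
    by (intro alg_closed Double_in_alg)
  finally have d: "d \<in> units.alg" .
  have "e = e ** ((\<Sum>l\<in>\<Lambda>2. G l) + (Q \<alpha> + Q \<beta>))"
    by (simp add: Q_sum R2_def)
  also have "\<dots> = (\<Sum>l\<in>\<Lambda>2. mscale (- 1 - l) (G l)) + (mscale \<alpha> (Q \<alpha>) + mscale \<beta> (Q \<beta>))"
    by (simp add: matrix_add_ldistrib matrix_sum_ldistrib e_G e_Q)
  also have "\<dots> \<in> units.alg"
    by (intro alg_closed Double_in_alg Q_in_alg)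
  finally have e: "e \<in> units.alg" .
  \<comment> \<open>\<open>H\<close> projects onto the primary module. The mixed terms vanish
    because \<open>A\<close> commutes with \<open>F1 + F2\<close>.\<close>
  define H where "H = (\<Sum>i<3. U i i)"
  have H: "H + (F1 + F2) = mat 1"
    using U_sum by (simp add: H_def add.assoc)
  have HF: "H ** (F1 + F2) = 0"
    by (simp add: H_def matrix_algebra U_F)
  have "A = A ** (H + (F1 + F2))"
    by (simp add: H)
  also have "\<dots> = A ** H + A ** (F1 + F2)"
    by (rule matrix_add_ldistrib)
  also have "A ** H = (H + (F1 + F2)) ** (A ** H)"
    by (simp only: H matrix_mul_lid)
  also have "\<dots> = H ** (A ** H) + ((F1 + F2) ** A) ** H"
    by (simp add: matrix_algebra)
  also have "((F1 + F2) ** A) ** H = A ** ((F1 + F2) ** H)"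
    by (simp only: A_commute[symmetric] matrix_mul_assoc)
  also have "(F1 + F2) ** H = 0"
    by (simp add: H_def matrix_algebra F_U)
  also have "H ** (A ** H) = (\<Sum>i<3. \<Sum>j<3. U i i ** (A ** U j j))"
    by (simp add: H_def matrix_sum_rdistrib) (simp add: matrix_sum_ldistrib)
  finally have A: "A = (\<Sum>i<3. \<Sum>j<3. U i i ** (A ** U j j)) + (b + c + d + e)"
    by (simp add: A_F)
  have "U i i ** (A ** U j j) \<in> units.alg" if "i < 3" "j < 3" for i j
    using U_sandwich[OF that, of A] U_in_alg[OF that] alg_closed(5) by metis
  then show ?thesis
    using b c d e by (subst A, intro alg_closed(3,7)) auto
qed

text \<open>Every unit is built from \<open>A\<close>, \<open>F1\<close>, \<open>F2\<close>,
  \<open>U\<close> and the \<open>P l\<close>. The condition on \<open>P\<close> will hold because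
  the projections are polynomials in \<open>b\<close>.\<close>

lemma alg_subset:
  assumes T: "matrix_subalgebra T"
    and in_T: "A \<in> T" "F1 \<in> T" "F2 \<in> T" "\<And>i j. i < 3 \<Longrightarrow> j < 3 \<Longrightarrow> U i j \<in> T"
    and P_T: "\<And>l. b \<in> T \<Longrightarrow> P l \<in> T"
  shows "units.alg \<subseteq> T"
proof -
  note closed = matrix_subalgebra_closed[OF T] mat_vs.subspace_sum[OF matrix_subalgebra_subspace[OF T]]
  have abcd: "b \<in> T" "c \<in> T" "d \<in> T" "e \<in> T"
    using in_T by (simp_all add: b_def c_def d_def e_def closed)
  have P: "P l \<in> T" for l
    by (rule P_T[OF abcd(1)])
  have R2: "R2 \<in> T"
    unfolding R2_def G_def using abcd P in_T by (intro closed) auto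
  have Q: "Q l \<in> T" for l
    unfolding Q_def comb_def using R2 abcd by (simp add: closed)
  have "unit r i j \<in> T" if "r \<in> blocks" "i < sz r" "j < sz r" for r i j
    using that abcd P Q in_T by (cases r) (auto simp: unit_def closed simp del: mat_vs.scale_minus_left)
  then have "units.units \<subseteq> T"
    by (auto simp: units.units_def)
  then show ?thesis
    unfolding units.alg_def by (intro mat_vs.span_minimal matrix_subalgebra_subspace[OF T])
qed

text \<open>The four projections at \<alpha> and \<beta> have equal rank, so they vanish together or
  not at all.\<close>

lemma blocks_1:
  "{r \<in> blocks. sz r = 1} = (if P \<alpha> = 0 then {} else {Out \<alpha>, Out \<beta>, In \<alpha>, In \<beta>})"
proof -
  have "{r \<in> blocks. sz r = 1} = Out ` {l \<in> {\<alpha>, \<beta>}. P l \<noteq> 0} \<union> In ` {l \<in> {\<alpha>, \<beta>}. Q l \<noteq> 0}"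
    by (auto simp: blocks_def)
  then show ?thesis
    using nonzero_iff by auto
qed

lemma card_blocks_1: "card {r \<in> blocks. sz r = 1} = (if P \<alpha> = 0 then 0 else 4)"
  unfolding blocks_1 using \<alpha>\<beta>(1) by simp

lemma card_blocks_2: "card {r \<in> blocks. sz r = 2} = card \<Lambda>2"
proof -
  have "{r \<in> blocks. sz r = 2} = Double ` \<Lambda>2"
    by (auto simp: blocks_def)
  then show ?thesis
    by (simp add: card_image inj_on_def)
qed

lemma dim_alg: "mat_vs.dim units.alg = 9 + (if P \<alpha> = 0 then 0 else 4) + 4 * card \<Lambda>2"
proof -
  have split: "(\<Sum>r\<in>blocks. (sz r)\<^sup>2) = 9 + 4 * card \<Lambda>2
    + (card {l \<in> {\<alpha>, \<beta>}. P l \<noteq> 0} + card {l \<in> {\<alpha>, \<beta>}. Q l \<noteq> 0})"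
    by (simp add: sum_blocks)
  have "{l \<in> {\<alpha>, \<beta>}. P l \<noteq> 0} = (if P \<alpha> = 0 then {} else {\<alpha>, \<beta>})"
    "{l \<in> {\<alpha>, \<beta>}. Q l \<noteq> 0} = (if P \<alpha> = 0 then {} else {\<alpha>, \<beta>})"
    using nonzero_iff by auto
  then show ?thesis
    using \<alpha>\<beta>(1) by (simp add: units.dim_alg split)
qed

end

section \<open>Doubly regular tournaments\<close>

locale doubly_regular_tournament =
  fixes R :: "('n::finite \<times> 'n) set" and x :: 'n and u :: nat
  assumes irrefl: "(y, y) \<notin> R"
    and asym: "(y, z) \<in> R \<Longrightarrow> (z, y) \<notin> R"
    and total: "y \<noteq> z \<Longrightarrow> (y, z) \<in> R \<or> (z, y) \<in> R"
    and card_UNIV: "CARD('n) = 4 * u + 3"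
    and out_degree: "card {z. (y, z) \<in> R} = 2 * u + 1"
    and in_degree: "card {z. (z, y) \<in> R} = 2 * u + 1"
    and common_out: "y \<noteq> z \<Longrightarrow> card {w. (y, w) \<in> R \<and> (z, w) \<in> R} = u"
begin

definition a :: "'n \<Rightarrow> 'n \<Rightarrow> complex" where
  "a y z = of_bool ((y, z) \<in> R)"

definition A :: "complex^'n^'n" where
  "A = adjacency R"

lemma A_nth [simp]: "A $ y $ z = a y z"
  by (simp add: A_def adjacency_def a_def)

lemma a_sum: "a y z + a z y + of_bool (y = z) = 1"
  using irrefl asym[of y z] asym[of z y] total[of y z] by (auto simp: a_def)

lemma row_sum: "(\<Sum>z\<in>UNIV. a y z) = of_nat (2 * u + 1)"
  using out_degree[of y] unfolding a_def by (simp del: of_nat_Suc of_nat_add of_nat_mult)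

lemma col_sum: "(\<Sum>y\<in>UNIV. a y z) = of_nat (2 * u + 1)"
  using in_degree[of z] unfolding a_def by (simp del: of_nat_Suc of_nat_add of_nat_mult)

lemma a_gram: "(\<Sum>w\<in>UNIV. a y w * a z w) = (if y = z then of_nat (2 * u + 1) else of_nat u)"
proof -
  have "(\<Sum>w\<in>UNIV. a y w * a z w) = of_nat (card {w. (y, w) \<in> R \<and> (z, w) \<in> R})"
    by (simp add: a_def flip: of_bool_conj)
  then show ?thesis
    using common_out[of y z] out_degree[of y] by (auto simp del: of_nat_Suc of_nat_add of_nat_mult)
qed

lemma a_transpose: "a z w = 1 - a w z - of_bool (w = z)"
  using a_sum[of z w] by (auto simp: algebra_simps)

text \<open>Replacing \<open>a w z\<close> by \<open>1 - a z w - of_bool (w = z)\<close> reduces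
  paths of length 2 to row sums and common out-neighbours.\<close>

lemma a_square: "(\<Sum>w\<in>UNIV. a y w * a w z) = of_nat (u + 1) - a y z - of_nat (u + 1) * of_bool (y = z)"
proof -
  have "(\<Sum>w\<in>UNIV. a y w * a w z) = (\<Sum>w\<in>UNIV. a y w - a y w * a z w - a y w * of_bool (w = z))"
    by (intro sum.cong refl) (subst a_transpose[of _ z], simp add: algebra_simps eq_commute)
  also have "\<dots> = (\<Sum>w\<in>UNIV. a y w) - (\<Sum>w\<in>UNIV. a y w * a z w) - (\<Sum>w\<in>UNIV. a y w * of_bool (w = z))"
    by (simp add: sum_subtractf)
  also have "(\<Sum>w\<in>UNIV. a y w * of_bool (w = z)) = a y z"
    by (simp add: of_bool_def if_distrib cong: if_cong)
  finally show ?thesis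
    by (auto simp: row_sum a_gram)
qed

section \<open>The three cells around \<open>x\<close> and the primary module\<close>

definition chi :: "nat \<Rightarrow> 'n \<Rightarrow> complex" where
  "chi i y = (if i = 0 then of_bool (x = y) else if i = 1 then a x y else a y x)"

lemma chi_simps: "chi 0 y = of_bool (x = y)" "chi 1 y = a x y" "chi (Suc 0) y = a x y" "chi 2 y = a y x"
  by (simp_all add: chi_def)

definition k :: "nat \<Rightarrow> complex" where
  "k i = (if i = 0 then 1 else of_nat (2 * u + 1))"

lemma k_nonzero [simp]: "k i \<noteq> 0"
  unfolding k_def by (auto simp del: of_nat_add of_nat_mult of_nat_Suc)

lemma less_3: "i < 3 \<longleftrightarrow> i = 0 \<or> i = 1 \<or> i = (2::nat)"
  by auto

lemma point_cases:
  obtains "y = x" "a x y = 0" "a y x = 0" | "y \<noteq> x" "a x y = 1" "a y x = 0"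
    | "y \<noteq> x" "a x y = 0" "a y x = 1"
  using irrefl asym total[of x y] by (auto simp: a_def)

lemma chi_mult: "i < 3 \<Longrightarrow> j < 3 \<Longrightarrow> chi i y * chi j y = (if i = j then chi i y else 0)"
  by (rule point_cases[of y]) (auto simp: chi_def less_3)

lemma chi_total: "(\<Sum>i<3. chi i y) = 1"
  by (rule point_cases[of y]) (auto simp: chi_def numeral_3_eq_3)

lemma chi_card: "i < 3 \<Longrightarrow> (\<Sum>y\<in>UNIV. chi i y) = k i"
  using row_sum[of x] col_sum[of x] by (auto simp: chi_def k_def less_3)

lemma chi_gram: "i < 3 \<Longrightarrow> j < 3 \<Longrightarrow> (\<Sum>y\<in>UNIV. chi i y * chi j y) = (if i = j then k i else 0)"
  by (simp add: chi_mult chi_card)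

definition E :: "nat \<Rightarrow> complex^'n^'n" where
  "E i = (\<chi> y z. if y = z then chi i y else 0)"

text \<open>\<open>U i i\<close> is the orthogonal projection onto the indicator
  \<open>chi i\<close>. Dividing by \<open>k j\<close> alone gives
  \<open>U i j ** U j m = U i m\<close> without square roots.\<close>

definition U :: "nat \<Rightarrow> nat \<Rightarrow> complex^'n^'n" where
  "U i j = (\<chi> y z. chi i y * chi j z / k j)"

text \<open>Removing the constants from a cell leaves the vectors of zero sum supported on
  it.\<close>

definition "F1 = E 1 - U 1 1"
definition "F2 = E 2 - U 2 2"

lemma E_nth [simp]: "E i $ y $ z = (if y = z then chi i y else 0)"
  by (simp add: E_def)

lemma U_nth [simp]: "U i j $ y $ z = chi i y * chi j z / k j"
  by (simp add: U_def)

lemma U_mult: "\<lbrakk>i < 3; j < 3; l < 3; m < 3\<rbrakk> \<Longrightarrow> U i j ** U l m = (if j = l then U i m else 0)"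
proof -
  assume *: "i < 3" "j < 3" "l < 3" "m < 3"
  have "(U i j ** U l m) $ y $ z = chi i y * chi m z / (k j * k m) * (\<Sum>w\<in>UNIV. chi j w * chi l w)" for y z
    by (simp add: matrix_mult_nth sum_distrib_left sum_divide_distrib mult_ac)
  then show ?thesis
    using * by (auto simp: vec_eq_iff chi_gram)
qed

lemma E_mult_nth: "(E i ** M) $ y $ z = chi i y * M $ y $ z"
  and mult_E_nth: "(M ** E i) $ y $ z = M $ y $ z * chi i z" for M :: "complex^'n^'n"
  by (simp_all add: matrix_mult_nth mult_delta_left mult_delta_right)

lemma E_mult: "i < 3 \<Longrightarrow> j < 3 \<Longrightarrow> E i ** E j = (if i = j then E i else 0)"
proof -
  assume *: "i < 3" "j < 3"
  have "(E i ** E j) $ y $ z = (if y = z then chi i y * chi j y else 0)" for y z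
    by (simp add: E_mult_nth mult_E_nth)
  then show ?thesis
    using * by (auto simp: vec_eq_iff chi_mult)
qed

lemma E_U: "i < 3 \<Longrightarrow> j < 3 \<Longrightarrow> E i ** U j l = (if i = j then U j l else 0)"
proof -
  assume *: "i < 3" "j < 3"
  have "(E i ** U j l) $ y $ z = (chi i y * chi j y) * chi l z / k l" for y z
    by (simp add: E_mult_nth mult_E_nth)
  then show ?thesis
    using * by (auto simp: vec_eq_iff chi_mult)
qed

lemma U_E: "j < 3 \<Longrightarrow> l < 3 \<Longrightarrow> U i j ** E l = (if j = l then U i j else 0)"
proof -
  assume *: "j < 3" "l < 3"
  have "(U i j ** E l) $ y $ z = chi i y * (chi j z * chi l z) / k j" for y z
    by (simp add: E_mult_nth mult_E_nth)
  then show ?thesis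
    using * by (auto simp: vec_eq_iff chi_mult)
qed

lemma E_sum: "E 0 + E 1 + E 2 = mat 1"
  using chi_total by (auto simp: vec_eq_iff mat_def numeral_3_eq_3 numeral_2_eq_2)

lemma E_0: "E 0 = U 0 0"
  by (auto simp: vec_eq_iff chi_def k_def)

lemma F_mult: "F1 ** F1 = F1" "F2 ** F2 = F2" "F1 ** F2 = 0" "F2 ** F1 = 0"
  by (simp_all add: F1_def F2_def matrix_algebra E_mult E_U U_E U_mult)

lemma U_F: "i < 3 \<Longrightarrow> j < 3 \<Longrightarrow> U i j ** F1 = 0" "i < 3 \<Longrightarrow> j < 3 \<Longrightarrow> U i j ** F2 = 0"
  and F_U: "i < 3 \<Longrightarrow> j < 3 \<Longrightarrow> F1 ** U i j = 0" "i < 3 \<Longrightarrow> j < 3 \<Longrightarrow> F2 ** U i j = 0"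
  by (simp_all add: F1_def F2_def matrix_algebra E_U U_E U_mult)

lemma U_sum: "(\<Sum>i<3. U i i) + F1 + F2 = mat 1"
  by (simp add: F1_def F2_def numeral_3_eq_3 numeral_2_eq_2 E_sum[symmetric] E_0)

lemma U_sandwich: "\<exists>s. U i i ** (M ** U j j) = mscale s (U i j)"
proof
  show "U i i ** (M ** U j j) = mscale ((\<Sum>w\<in>UNIV. \<Sum>v\<in>UNIV. chi i w * M $ w $ v * chi j v) / k i) (U i j)"
    by (simp add: vec_eq_iff matrix_mult_nth mscale_def sum_distrib_left sum_distrib_right sum_divide_distrib
        mult_ac)
qed

text \<open>The indicators \<open>chi\<close> sum to 1, so each right-hand side lies in their span,
  and \<open>A\<close> preserves the primary module.\<close>

lemma A_chi:
  "(\<Sum>w\<in>UNIV. a y w * chi 0 w) = chi 2 y"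
  "(\<Sum>w\<in>UNIV. a y w * chi 2 w) = of_nat (u + 1) - chi 2 y - of_nat (u + 1) * chi 0 y"
  "(\<Sum>w\<in>UNIV. a y w * chi 1 w) = of_nat u + of_nat (u + 1) * chi 0 y"
proof -
  show 0: "(\<Sum>w\<in>UNIV. a y w * chi 0 w) = chi 2 y"
    by (simp add: chi_simps of_bool_def if_distrib cong: if_cong)
  show 2: "(\<Sum>w\<in>UNIV. a y w * chi 2 w) = of_nat (u + 1) - chi 2 y - of_nat (u + 1) * chi 0 y"
    using a_square[of y x] by (auto simp: chi_def eq_commute[of x])
  show "(\<Sum>w\<in>UNIV. a y w * chi 1 w) = of_nat u + of_nat (u + 1) * chi 0 y"
    using a_gram[of y x] by (auto simp: chi_def)
qed

lemma chi_A:
  "(\<Sum>w\<in>UNIV. chi 0 w * a w z) = chi 1 z"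
  "(\<Sum>w\<in>UNIV. chi 1 w * a w z) = of_nat (u + 1) - chi 1 z - of_nat (u + 1) * chi 0 z"
  "(\<Sum>w\<in>UNIV. chi 2 w * a w z) = of_nat u + of_nat (u + 1) * chi 0 z"
proof -
  show 0: "(\<Sum>w\<in>UNIV. chi 0 w * a w z) = chi 1 z"
    by (simp add: chi_def of_bool_def if_distrib if_distribR cong: if_cong)
  show 1: "(\<Sum>w\<in>UNIV. chi 1 w * a w z) = of_nat (u + 1) - chi 1 z - of_nat (u + 1) * chi 0 z"
    using a_square[of x z] by (auto simp: chi_def)
  \<comment> \<open>The third identity is what the other two leave of the column sum.\<close>
  have "(\<Sum>w\<in>UNIV. (\<Sum>i<3. chi i w) * a w z) = of_nat (2 * u + 1)"
    by (simp add: chi_total col_sum del: of_nat_add of_nat_mult)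
  then have "(\<Sum>w\<in>UNIV. chi 0 w * a w z) + (\<Sum>w\<in>UNIV. chi 1 w * a w z)
      + (\<Sum>w\<in>UNIV. chi 2 w * a w z) = of_nat (2 * u + 1)"
    by (simp add: numeral_3_eq_3 numeral_2_eq_2 distrib_right sum.distrib)
  then show "(\<Sum>w\<in>UNIV. chi 2 w * a w z) = of_nat u + of_nat (u + 1) * chi 0 z"
    unfolding 0 1 by (simp add: algebra_simps)
qed

definition H :: "complex^'n^'n" where
  "H = U 0 0 + U 1 1 + U 2 2"

lemma F_H: "F1 + F2 = mat 1 - H"
  using U_sum by (simp add: H_def numeral_3_eq_3 numeral_2_eq_2 algebra_simps)

lemma A_H: "A ** H = H ** A"
proof -
  define n where "n = complex_of_nat (2 * u + 1)"
  have n: "n \<noteq> 0" "k 0 = 1" "k 1 = n" "k 2 = n" "2 * of_nat u + 1 = n"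
    using k_nonzero[of 1] by (simp_all add: n_def k_def)
  have left: "(A ** U i i) $ y $ z = (\<Sum>w\<in>UNIV. a y w * chi i w) * chi i z / k i" for i y z
    by (simp add: matrix_mult_nth sum_distrib_right sum_divide_distrib mult.assoc)
  have right: "(U i i ** A) $ y $ z = chi i y * (\<Sum>w\<in>UNIV. chi i w * a w z) / k i" for i y z
    by (simp add: matrix_mult_nth sum_distrib_left sum_divide_distrib mult.assoc)
  \<comment> \<open>Both entries depend only on the cells of \<open>y\<close> and \<open>z\<close>,
    which leaves nine cases.\<close>
  have "(A ** H) $ y $ z = (H ** A) $ y $ z" for y z
    unfolding H_def matrix_add_ldistrib matrix_mult_add_left vector_add_component left right
      A_chi chi_A n
    by (rule point_cases[of y]; rule point_cases[of z]) (simp_all add: chi_def n)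
  then show ?thesis
    by (simp add: vec_eq_iff)
qed

lemma A_F: "A ** (F1 + F2) = (F1 + F2) ** A"
  by (simp add: F_H matrix_algebra A_H)

definition J :: "complex^'n^'n" where
  "J = (\<chi> y z. 1)"

text \<open>The columns of \<open>J\<close> are the all-ones vector, the sum of the cell indicators
  fixed by \<open>H\<close>. Hence \<open>J\<close> vanishes on the complement.\<close>

lemma H_J: "H ** J = J"
proof -
  have "(U i i ** J) $ y $ z = chi i y" if "i < 3" for i y z
    using chi_card[OF that] that
    by (simp add: matrix_mult_nth J_def flip: sum_divide_distrib sum_distrib_left)
  then show ?thesis
    using chi_total by (simp add: H_def vec_eq_iff matrix_mult_add_left J_def numeral_3_eq_3 numeral_2_eq_2)
qed

lemma F_J: "(F1 + F2) ** J = 0"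
  by (simp add: F_H matrix_algebra H_J)

lemma A_square: "A ** A + A + mscale (of_nat (u + 1)) (mat 1) = mscale (of_nat (u + 1)) J"
  by (auto simp: vec_eq_iff matrix_mult_nth a_square mscale_def mat_def J_def)

lemma A_transpose: "transpose A = J - mat 1 - A"
proof -
  have "transpose A $ y $ z = (J - mat 1 - A) $ y $ z" for y z
    using a_transpose[of z y] by (simp add: transpose_def J_def mat_def)
  then show ?thesis
    by (simp add: vec_eq_iff)
qed


lemma trace_F: "trace F1 = of_nat (2 * u)" "trace F2 = of_nat (2 * u)"
proof -
  have "trace (E i) = k i" "trace (U i i) = 1" if "i < 3" for i
    using chi_card[OF that] chi_gram[OF that that]
    by (simp_all add: trace_def flip: sum_divide_distrib)
  then show "trace F1 = of_nat (2 * u)" "trace F2 = of_nat (2 * u)"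
    by (simp_all add: F1_def F2_def trace_sub k_def)
qed

lemma F_symmetric: "transpose F1 = F1" "transpose F2 = F2"
  and F_hermitian: "adjoint_matrix F1 = F1" "adjoint_matrix F2 = F2"
  and A_real: "adjoint_matrix A = transpose A"
  by (auto simp: vec_eq_iff transpose_def adjoint_matrix_def F1_def F2_def chi_def k_def a_def)

definition \<alpha> :: complex where "\<alpha> = (- 1 + csqrt (- of_nat CARD('n))) / 2"
definition \<beta> :: complex where "\<beta> = (- 1 - csqrt (- of_nat CARD('n))) / 2"

lemma \<alpha>\<beta>: "\<alpha> \<noteq> \<beta>" "\<alpha> + \<beta> = - 1" "\<alpha> * \<beta> = of_nat (u + 1)"
proof -
  define s where "s = csqrt (- of_nat CARD('n))"
  have s: "s * s = - (4 * of_nat u + 3)"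
    unfolding s_def power2_eq_square[symmetric] power2_csqrt by (simp add: card_UNIV)
  have "s \<noteq> 0"
    by (simp add: s_def)
  then show "\<alpha> \<noteq> \<beta>"
    by (simp add: \<alpha>_def \<beta>_def flip: s_def)
  show "\<alpha> + \<beta> = - 1"
    by (simp add: \<alpha>_def \<beta>_def field_simps)
  have "\<alpha> * \<beta> = (1 - s * s) / 4"
    by (simp add: \<alpha>_def \<beta>_def algebra_simps flip: s_def)
  also have "\<dots> = of_nat (u + 1)"
    unfolding s by (simp add: field_simps)
  finally show "\<alpha> * \<beta> = of_nat (u + 1)" .
qed

sublocale corner F1 F2 A u \<alpha> \<beta>
proof
  show "(F1 + F2) ** transpose A = - (F1 + F2) - (F1 + F2) ** A"
    by (simp add: A_transpose matrix_diff_ldistrib F_J)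
  then show "(F1 + F2) ** adjoint_matrix A = - (F1 + F2) - (F1 + F2) ** A"
    by (simp add: A_real)
  have "(F1 + F2) ** (A ** A + A + mscale (of_nat (u + 1)) (mat 1)) = 0"
    unfolding A_square by (simp add: mscale_mult_right F_J)
  then show "(F1 + F2) ** (A ** A) + (F1 + F2) ** A + mscale (of_nat (u + 1)) (F1 + F2) = 0"
    by (simp add: matrix_add_ldistrib mscale_mult_right)
qed (fact F_mult F_hermitian F_symmetric A_F trace_F \<alpha>\<beta>)+

text \<open>The second conclusion is what later puts the projections into the Terwilliger
  algebra.\<close>

lemma corner_units_exists:
  obtains \<Lambda> P where "corner_units F1 F2 A u \<alpha> \<beta> \<Lambda> P U"
    and "\<And>T l. matrix_subalgebra T \<Longrightarrow> b \<in> T \<Longrightarrow> P l \<in> T"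
proof -
  obtain \<Lambda> P where "finite \<Lambda>" "\<And>l. l \<in> \<Lambda> \<longleftrightarrow> P l \<noteq> 0"
    "\<And>l. b ** P l = mscale l (P l)" "\<And>l. P l ** b = mscale l (P l)"
    "\<And>l m. P l ** P m = (if l = m then P l else 0)" "(\<Sum>l\<in>\<Lambda>. P l) = mat 1"
    and *: "\<And>T l. matrix_subalgebra T \<Longrightarrow> b \<in> T \<Longrightarrow> P l \<in> T"
    by (rule normal_matrix_spectral[OF b_normal]) blast
  moreover have "U 0 0 \<noteq> 0"
    using irrefl by (auto simp: vec_eq_iff chi_def k_def intro!: exI[of _ x])
  ultimately have "corner_units F1 F2 A u \<alpha> \<beta> \<Lambda> P U"
    by unfold_locales (assumption | rule U_mult U_F F_U U_sum U_sandwich)+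
  then show ?thesis
    using * by (rule that)
qed

end

locale tournament_units = doubly_regular_tournament R x u
    + corner_units F1 F2 A u \<alpha> \<beta> \<Lambda> P U
  for R :: "('n::finite \<times> 'n) set" and x u \<Lambda> P +
  assumes P_in_subalgebra: "\<And>T l. matrix_subalgebra T \<Longrightarrow> b \<in> T \<Longrightarrow> P l \<in> T"
begin

declare One_nat_def [simp del]

section \<open>The local block and its \<alpha>-eigenspace\<close>

lemma F1_E_1: "F1 ** E 1 = F1" "E 1 ** F1 = F1"
  by (simp_all add: F1_def matrix_algebra E_mult E_U U_E)

text \<open>Each point of the out-neighbourhood of \<open>x\<close> has \<open>u\<close>
  in-neighbours inside it.\<close>

lemma U_A_E: "U 1 1 ** (A ** E 1) = mscale (of_nat u) (U 1 1)"
proof -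
  have "(U 1 1 ** (A ** E 1)) $ y $ z = (of_nat u) * (U 1 1 $ y $ z)" for y z
  proof -
    have "(U 1 1 ** (A ** E 1)) $ y $ z = chi 1 y / k 1 * ((\<Sum>w\<in>UNIV. chi 1 w * a w z) * chi 1 z)"
      unfolding matrix_mul_assoc mult_E_nth
      by (simp add: matrix_mult_nth sum_distrib_left sum_distrib_right sum_divide_distrib mult_ac)
    also have "(\<Sum>w\<in>UNIV. chi 1 w * a w z) * chi 1 z = of_nat u * chi 1 z"
      unfolding chi_A by (rule point_cases[of z]) (auto simp: chi_simps)
    finally show ?thesis
      by simp
  qed
  then show ?thesis
    by (simp add: vec_eq_iff mscale_def)
qed

text \<open>Otherwise \<open>\<beta> = - 1 - u\<close>, and
  \<open>\<alpha> * \<beta> = u + 1\<close> would become \<open>(u + 1)\<close> squared equal to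
  0.\<close>

lemma \<alpha>_neq_u: "\<alpha> \<noteq> of_nat u"
proof
  assume "\<alpha> = of_nat u"
  moreover from this have "\<beta> = - 1 - of_nat u"
    using \<alpha>\<beta>(2) by (simp add: eq_diff_eq add.commute)
  ultimately have "of_nat u * (- 1 - of_nat u) = complex_of_nat (u + 1)"
    using \<alpha>\<beta>(3) by simp
  moreover have "complex_of_nat (u * (u + 1) + (u + 1)) = of_nat (u + 1) - of_nat u * (- 1 - of_nat u)"
    by (simp add: algebra_simps)
  ultimately have "complex_of_nat (u * (u + 1) + (u + 1)) = 0"
    by simp
  then show False
    unfolding of_nat_eq_0_iff by simp
qed

context
  fixes idx :: "'m::finite \<Rightarrow> 'n" and B :: "complex^'m^'m"
  assumes block: "is_local_block R x idx B"
begin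

text \<open>The inclusion of the coordinates of \<open>B\<close> into those of the full space; it
  carries eigenvectors of the small matrix to vectors supported on the out-neighbourhood.\<close>

definition K :: "complex^'m^'n" where
  "K = (\<chi> y i. if y = idx i then 1 else 0)"

lemma inj_idx: "inj idx" and range_idx: "range idx = {y. (x, y) \<in> R}"
  using block by (auto simp: is_local_block_def bij_betw_def)

lemma K_gram: "transpose K ** K = mat 1" "K ** transpose K = E 1"
proof -
  have "(transpose K ** K) $ i $ j = (if i = j then 1 else 0)" for i j
    by (simp add: matrix_matrix_mult_def transpose_def K_def mult_delta_left inj_eq[OF inj_idx])
  then show "transpose K ** K = mat 1"
    by (simp add: vec_eq_iff mat_def)
  have "(K ** transpose K) $ y $ z = (if y = z then chi 1 y else 0)" for y z
  proof (cases "y \<in> range idx")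
    case True
    then obtain i where i: "y = idx i"
      by auto
    then have "chi 1 y = 1"
      using range_idx by (auto simp: chi_simps a_def)
    then show ?thesis
      by (auto simp: i matrix_matrix_mult_def transpose_def K_def mult_delta_left inj_eq[OF inj_idx])
  next
    case False
    then have "chi 1 y = 0"
      using range_idx by (auto simp: chi_simps a_def)
    moreover have "y \<noteq> idx i" for i
      using False by auto
    ultimately show ?thesis
      by (auto simp: matrix_matrix_mult_def transpose_def K_def)
  qed
  then show "K ** transpose K = E 1"
    by (simp add: vec_eq_iff)
qed

lemma B_eq: "B = transpose K ** (A ** K)"
proof -
  have "dual_idempotent x R = E 1"
    by (simp add: dual_idempotent_def vec_eq_iff chi_simps a_def)
  then have B: "B = (\<chi> i j. (E 1 ** A ** E 1) $ idx i $ idx j)"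
    using block by (simp add: is_local_block_def A_def)
  have one: "chi 1 (idx i) = 1" for i
    using range_idx by (auto simp: chi_simps a_def)
  have "(E 1 ** A ** E 1) $ idx i $ idx j = a (idx i) (idx j)" for i j
    by (simp add: E_mult_nth mult_E_nth one)
  then show ?thesis
    unfolding B by (simp add: vec_eq_iff matrix_matrix_mult_def transpose_def K_def
        mult_delta_left mult_delta_right)
qed

lemma E_K: "E 1 ** K = K" "transpose K ** E 1 = transpose K"
  by (simp_all only: K_gram(2)[symmetric] matrix_mul_assoc[symmetric] K_gram(1) matrix_mul_rid)
    (simp only: K_gram(1) matrix_mul_assoc matrix_mul_lid)

text \<open>\<open>B\<close> has constant column sums \<open>u \<noteq> \<alpha>\<close>, so its \<open>\<alpha>\<close>-eigenvectors have zero sum.\<close>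

lemma image_eigenspace: "(*v) K ` eigenspace B \<alpha> = range ((*v) (P \<alpha>))"
proof (intro equalityI subsetI)
  fix w assume "w \<in> (*v) K ` eigenspace B \<alpha>"
  then obtain v where v: "B *v v = \<alpha> *s v" "w = K *v v"
    by (auto simp: eigenspace_def)
  have E_w: "E 1 *v w = w"
    by (simp add: v(2) matrix_vector_mul_assoc E_K)
  have "E 1 *v (A *v w) = K *v (B *v v)"
    by (simp add: v(2) matrix_vector_mul_assoc B_eq matrix_mul_assoc K_gram)
  then have EA_w: "E 1 *v (A *v w) = \<alpha> *s w"
    by (simp add: v vec.scale)
  \<comment> \<open>Evaluated in two ways, this scales \<open>U 1 1 *v w\<close> by \<open>u\<close>
    and by \<alpha>. So the constant part of \<open>w\<close> is 0 and \<open>w\<close> lies in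
    \<open>V\<^sub>1\<close>.\<close>
  have "of_nat u *s (U 1 1 *v w) = U 1 1 *v (A *v (E 1 *v w))"
    by (simp add: matrix_vector_mul_assoc U_A_E mscale_vector_mult flip: matrix_mul_assoc)
  also have "\<dots> = U 1 1 *v (E 1 *v (A *v w))"
    by (simp add: E_w) (simp add: matrix_vector_mul_assoc matrix_mul_assoc U_E)
  also have "\<dots> = \<alpha> *s (U 1 1 *v w)"
    by (simp add: EA_w vec.scale)
  finally have U_w: "U 1 1 *v w = 0"
    using \<alpha>_neq_u by (metis vec.scale_right_imp_eq)
  then have F1_w: "F1 *v w = w"
    by (simp add: F1_def matrix_vector_mult_diff_rdistrib E_w)
  have "b *v w = F1 *v (A *v (F1 *v w))"
    by (simp add: b_def matrix_vector_mul_assoc matrix_mul_assoc)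
  also have "\<dots> = F1 *v (E 1 *v (A *v w))"
    by (simp add: F1_w matrix_vector_mul_assoc matrix_mul_assoc F1_E_1)
  also have "\<dots> = \<alpha> *s w"
    by (simp add: EA_w vec.scale F1_w)
  finally have b_w: "b *v w = \<alpha> *s w" .
  have zero: "P l *v w = 0" if "l \<noteq> \<alpha>" for l
  proof -
    have "l *s (P l *v w) = P l *v (b *v w)"
      by (simp add: matrix_vector_mul_assoc P_b mscale_vector_mult)
    also have "\<dots> = \<alpha> *s (P l *v w)"
      by (simp add: b_w vec.scale)
    finally show ?thesis
      using that by (metis vec.scale_right_imp_eq)
  qed
  have sum_vec: "sum f X *v w = (\<Sum>l\<in>X. f l *v w)" for f :: "complex \<Rightarrow> complex^'n^'n" and X
    by (induction X rule: infinite_finite_induct) (simp_all add: matrix_vector_mult_add_rdistrib)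
  have "w = (\<Sum>l\<in>\<Lambda>. P l) *v w"
    by (simp add: P_sum)
  also have "\<dots> = (\<Sum>l\<in>\<Lambda>. if l = \<alpha> then P \<alpha> *v w else 0)"
    unfolding sum_vec by (intro sum.cong) (auto simp: zero)
  also have "\<dots> = P \<alpha> *v w"
    using finite_\<Lambda> P_nonzero[of \<alpha>] by auto
  finally show "w \<in> range ((*v) (P \<alpha>))"
    by (rule range_eqI)
next
  fix w assume "w \<in> range ((*v) (P \<alpha>))"
  then obtain z where z: "w = P \<alpha> *v z"
    by auto
  have F1_w: "F1 *v w = w" and b_w: "b *v w = \<alpha> *s w"
    using F1_P[OF \<alpha>\<beta>_nonzero(1)] by (simp_all add: z matrix_vector_mul_assoc b_P mscale_vector_mult)
  have E_w: "E 1 *v w = w"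
    using F1_w by (metis F1_E_1(2) matrix_vector_mul_assoc)
  have U_w: "U 1 1 *v w = 0"
    using F1_w E_w by (simp add: F1_def matrix_vector_mult_diff_rdistrib)
  \<comment> \<open>Here \<open>E 1 = F1 + U 1 1\<close>: the first part gives
    \<open>b *v w\<close>, the second vanishes by \<open>U_A_E\<close>.\<close>
  have "E 1 *v (A *v w) = F1 *v (A *v (F1 *v w)) + U 1 1 *v (A *v (E 1 *v w))"
    by (simp add: F1_w E_w) (simp add: F1_def matrix_vector_mult_diff_rdistrib)
  also have "F1 *v (A *v (F1 *v w)) = \<alpha> *s w"
    using b_w by (simp add: b_def matrix_vector_mul_assoc matrix_mul_assoc)
  also have "U 1 1 *v (A *v (E 1 *v w)) = 0"
    by (simp add: matrix_vector_mul_assoc U_A_E mscale_vector_mult U_w flip: matrix_mul_assoc)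
  finally have EA_w: "E 1 *v (A *v w) = \<alpha> *s w"
    by simp
  have K: "K *v (transpose K *v w) = w"
    using E_w by (simp only: matrix_vector_mul_assoc K_gram)
  have "B *v (transpose K *v w) = transpose K *v (A *v (K *v (transpose K *v w)))"
    by (simp only: B_eq matrix_vector_mul_assoc matrix_mul_assoc)
  also have "\<dots> = transpose K *v (E 1 *v (A *v w))"
    unfolding K by (simp only: matrix_vector_mul_assoc matrix_mul_assoc E_K)
  also have "\<dots> = \<alpha> *s (transpose K *v w)"
    by (simp only: EA_w vec.scale)
  finally have "transpose K *v w \<in> eigenspace B \<alpha>"
    unfolding eigenspace_def by blast
  then show "w \<in> (*v) K ` eigenspace B \<alpha>"
    using K by (metis image_eqI)
qed

lemma inj_K: "inj ((*v) K)"
proof (rule injI)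
  fix v w assume "K *v v = K *v w"
  then have "transpose K *v (K *v v) = transpose K *v (K *v w)"
    by (rule arg_cong)
  then show "v = w"
    by (simp only: matrix_vector_mul_assoc K_gram matrix_vector_mul_lid)
qed

lemma dim_eigenspace: "vec.dim (eigenspace B \<alpha>) = vec.dim (range ((*v) (P \<alpha>)))"
  unfolding image_eigenspace[symmetric]
  by (rule vec.dim_image_eq[symmetric]) (auto intro: inj_on_subset[OF inj_K])

lemma is_eigenvalue_iff: "is_eigenvalue B \<alpha> \<longleftrightarrow> P \<alpha> \<noteq> 0"
proof -
  have "is_eigenvalue B \<alpha> \<longleftrightarrow> (\<exists>v\<in>eigenspace B \<alpha>. v \<noteq> 0)"
    by (auto simp: is_eigenvalue_def eigenspace_def)
  also have "\<dots> \<longleftrightarrow> (\<exists>v\<in>eigenspace B \<alpha>. K *v v \<noteq> 0)"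
    using inj_K by (metis injD matrix_vector_mult_0_right)
  also have "\<dots> \<longleftrightarrow> (\<exists>w\<in>range ((*v) (P \<alpha>)). w \<noteq> 0)"
    unfolding image_eigenspace[symmetric] by blast
  also have "\<dots> \<longleftrightarrow> P \<alpha> \<noteq> 0"
    by (auto simp: matrix_eq)
  finally show ?thesis .
qed

end

section \<open>Identification of the Terwilliger algebra and the primary module\<close>

lemma E_U_F: "E 0 = U 0 0" "E 1 = F1 + U 1 1" "E 2 = F2 + U 2 2"
  by (simp_all add: E_0 F1_def F2_def)

lemma J_eq: "J = (\<Sum>i<3. \<Sum>j<3. mscale (k j) (U i j))"
proof -
  have "(\<Sum>i<3. \<Sum>j<3. mscale (k j) (U i j)) $ y $ z = (\<Sum>i<3. chi i y) * (\<Sum>j<3. chi j z)" for y z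
    by (simp add: mscale_def sum_product)
  then show ?thesis
    by (simp add: vec_eq_iff J_def chi_total)
qed

lemma U_eq: "U i j = mscale (inverse (k j)) (E i ** (J ** E j))"
  by (simp add: vec_eq_iff mscale_def E_mult_nth mult_E_nth J_def divide_inverse mult_ac)

lemma generators:
  "adjacency Id = mat 1" "adjacency R = A" "adjacency (R\<inverse>) = J - mat 1 - A"
  "dual_idempotent x Id = E 0" "dual_idempotent x R = E 1" "dual_idempotent x (R\<inverse>) = E 2"
proof -
  show "adjacency (R\<inverse>) = J - mat 1 - A"
    unfolding A_transpose[symmetric]
    by (simp add: adjacency_def vec_eq_iff transpose_def a_def)
  show "adjacency Id = mat 1"
    by (simp add: adjacency_def vec_eq_iff mat_def)
qed (simp_all add: A_def dual_idempotent_def vec_eq_iff chi_simps a_def)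

lemma matrix_subalgebra_terwilliger: "matrix_subalgebra (terwilliger_algebra S z)"
  unfolding terwilliger_algebra_def
  by (rule hull_in) (auto simp: matrix_subalgebra_def intro!: mat_vs.subspace_Inter)

text \<open>All generators are combinations of units. Conversely \<open>J\<close> and the dual
  idempotents yield \<open>U\<close>, \<open>F1\<close> and \<open>F2\<close>, and \<open>A\<close>
  then yields the remaining units.\<close>

lemma terwilliger_eq: "terwilliger_algebra {Id, R, R\<inverse>} x = units.alg"
proof
  have J: "J \<in> units.alg"
    unfolding J_eq by (intro alg_closed U_in_alg) auto
  have "adjacency ` {Id, R, R\<inverse>} \<union> dual_idempotent x ` {Id, R, R\<inverse>} \<subseteq> units.alg"
    using J A_in_alg F_in_alg U_in_alg by (simp add: generators E_U_F alg_closed)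
  then show "terwilliger_algebra {Id, R, R\<inverse>} x \<subseteq> units.alg"
    unfolding terwilliger_algebra_def by (intro hull_minimal units.matrix_subalgebra_alg)
  let ?T = "terwilliger_algebra {Id, R, R\<inverse>} x"
  note T = matrix_subalgebra_terwilliger[of "{Id, R, R\<inverse>}" x]
  note closed = matrix_subalgebra_closed[OF T]
  have "adjacency ` {Id, R, R\<inverse>} \<union> dual_idempotent x ` {Id, R, R\<inverse>} \<subseteq> ?T"
    unfolding terwilliger_algebra_def by (rule hull_subset)
  then have gen: "A \<in> ?T" "J - mat 1 - A \<in> ?T" "E 0 \<in> ?T" "E 1 \<in> ?T" "E 2 \<in> ?T"
    by (auto simp: generators)
  have "J = (J - mat 1 - A) + mat 1 + A"
    by simp
  also have "\<dots> \<in> ?T"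
    by (intro closed(1,3) gen)
  finally have J': "J \<in> ?T" .
  have U: "U i j \<in> ?T" if "i < 3" "j < 3" for i j
  proof -
    have "E i \<in> ?T" "E j \<in> ?T"
      using gen that by (auto simp: less_3)
    then show ?thesis
      unfolding U_eq using J' by (intro closed)
  qed
  have "F1 \<in> ?T" "F2 \<in> ?T"
    unfolding F1_def F2_def using U gen by (auto intro!: closed(4))
  then show "units.alg \<subseteq> ?T"
    using gen U P_in_subalgebra[OF T] by (intro alg_subset[OF T])
qed

text \<open>\<open>v\<close> is the indicator of \<open>x\<close>. It generates the same module as
  the all-ones vector, since \<open>U 0 0\<close> maps the latter to \<open>v\<close> and the first
  column of \<open>U\<close> maps back; this places the module in block
  \<open>Primary\<close>.\<close>

lemma primary_module_generated:
  defines "v \<equiv> U 0 0 *v 1"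
  shows "v \<noteq> 0" "unit Primary 0 0 *v v = v" "primary_module units.alg = {M *v v | M. M \<in> units.alg}"
proof -
  have U_1: "(U i 0 *v 1) $ y = chi i y" for i y
    using chi_card[of 0]
    by (simp add: matrix_vector_mult_def k_def flip: sum_distrib_left sum_divide_distrib)
  have "v $ x = 1"
    by (simp add: v_def U_1 chi_simps)
  then show "v \<noteq> 0"
    by auto
  show "unit Primary 0 0 *v v = v"
    by (simp add: unit_def v_def matrix_vector_mul_assoc U_mult)
  define X where "X = U 0 0 + U 1 0 + U 2 0"
  have X: "X \<in> units.alg"
    by (simp add: X_def alg_closed U_in_alg)
  have "X ** U 0 0 = X"
    by (simp add: X_def matrix_algebra U_mult)
  then have "X *v v = X *v 1"
    by (simp add: v_def matrix_vector_mul_assoc)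
  also have "\<dots> = 1"
    using chi_total
    by (simp add: X_def vec_eq_iff matrix_vector_mult_add_rdistrib U_1 numeral_3_eq_3 numeral_2_eq_2
        One_nat_def)
  finally have X_v: "X *v v = 1" .
  have "\<exists>N\<in>units.alg. M *v 1 = N *v v" if "M \<in> units.alg" for M
    by (rule bexI[of _ "M ** X"])
      (simp_all add: X_v that X alg_closed(2) flip: matrix_vector_mul_assoc)
  moreover have "\<exists>N\<in>units.alg. M *v v = N *v 1" if "M \<in> units.alg" for M
    by (rule bexI[of _ "M ** U 0 0"])
      (simp_all add: v_def that U_in_alg alg_closed(2) flip: matrix_vector_mul_assoc)
  ultimately show "primary_module units.alg = {M *v v | M. M \<in> units.alg}"
    unfolding primary_module_def by blast
qed

text \<open>An irreducible module of block \<open>Primary\<close> is isomorphic to the primary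
  module, and all other blocks have size 1 or 2.\<close>

lemma dim_irreducible:
  assumes "vector_space smul" "irreducible_module units.alg smul W act"
    "\<not> modules_isomorphic units.alg smul W act (*s) (primary_module units.alg) (*v)"
  shows "vector_space.dim smul W = 1 \<or> vector_space.dim smul W = 2"
proof -
  obtain r w where r: "r \<in> blocks" "units.generates W act r w" "W = {act M w | M. M \<in> units.alg}"
    "vector_space.dim smul W = sz r"
    by (rule units.irreducible_module_generator[OF assms(1,2)])
  have "r \<noteq> Primary"
  proof
    assume "r = Primary"
    note p = primary_module_generated
    have "modules_isomorphic units.alg smul W act (*s) (primary_module units.alg) (*v) \<longleftrightarrow> r = Primary"
      unfolding p(3)
    proof (rule units.isomorphic_iff_same_block[OF assms(1) _ r(2,3) vec.vector_space_axioms])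
      show "is_module units.alg smul W act"
        using assms(2) by (simp add: irreducible_module_def)
      show "units.generates {M *v (U 0 0 *v 1) | M. M \<in> units.alg} (*v) Primary (U 0 0 *v 1)"
        by (rule units.standard_submodule_generator[OF _ p(2,1)]) (simp add: in_blocks)
    qed (rule units.standard_submodule refl)+
    then show False
      using assms(3) \<open>r = Primary\<close> by simp
  qed
  then show ?thesis
    using r(4) by (cases r) auto
qed

end

section \<open>Association schemes\<close>

lemma scheme_tournament:
  fixes S :: "('n::finite \<times> 'n) set set"
  assumes scheme: "association_scheme S" and card_S: "card S = 3"
    and R: "R \<in> S" "R\<inverse> \<noteq> R" and n: "CARD('n) = 4 * u + 3"
  shows "S = {Id, R, R\<inverse>}" "doubly_regular_tournament R u"
proof -
  have part: "partition_on UNIV S" and Id: "Id \<in> S" and R': "R\<inverse> \<in> S"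
    and p: "\<And>r s t. r \<in> S \<Longrightarrow> s \<in> S \<Longrightarrow> t \<in> S \<Longrightarrow>
      \<exists>p. \<forall>(y, z)\<in>t. card {w. (y, w) \<in> r \<and> (w, z) \<in> s} = p"
    using scheme R by (auto simp: association_scheme_def)
  have neq: "R \<noteq> Id" "R\<inverse> \<noteq> Id"
    using R(2) by (metis converse_Id, metis converse_Id converse_converse)
  have "finite S"
    using card_S by (simp add: card_ge_0_finite)
  moreover have "{Id, R, R\<inverse>} \<subseteq> S" "card {Id, R, R\<inverse>} = card S"
    using Id R R' neq card_S by auto
  ultimately show S: "S = {Id, R, R\<inverse>}"
    using card_subset_eq by metis
  have disj: "disjoint S" and "\<Union>S = UNIV"
    using part by (auto simp: partition_on_def)
  then have cover: "Id \<union> R \<union> R\<inverse> = UNIV"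
    by (auto simp: S)
  have "R \<inter> Id = {}" "R \<inter> R\<inverse> = {}"
    using disj Id R R' neq disjointD by blast+
  then have irrefl: "(y, y) \<notin> R" and asym: "(y, z) \<in> R \<Longrightarrow> (z, y) \<notin> R" for y z
    by auto
  have total: "(y, z) \<in> R \<or> (z, y) \<in> R" if "y \<noteq> z" for y z
  proof -
    have "(y, z) \<in> Id \<union> R \<union> R\<inverse>"
      unfolding cover by simp
    then show ?thesis
      using that by auto
  qed
  obtain k where "\<forall>(y, z)\<in>Id. card {w. (y, w) \<in> R \<and> (w, z) \<in> R\<inverse>} = k"
    using p[OF R(1) R' Id] by blast
  from bspec[OF this, of "(y, y)" for y] have k: "card {w. (y, w) \<in> R} = k" for y
    by simp
  obtain k' where "\<forall>(y, z)\<in>Id. card {w. (y, w) \<in> R\<inverse> \<and> (w, z) \<in> R} = k'"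
    using p[OF R' R(1) Id] by blast
  from bspec[OF this, of "(y, y)" for y] have k': "card {w. (w, y) \<in> R} = k'" for y
    by simp
  \<comment> \<open>Counting the arcs by tails and by heads shows that out-degree and in-degree
    agree.\<close>
  have "R = (SIGMA y:UNIV. {w. (y, w) \<in> R})" "R\<inverse> = (SIGMA y:UNIV. {w. (w, y) \<in> R})"
    by auto
  then have "card R = CARD('n) * k" "card (R\<inverse>) = CARD('n) * k'"
    using card_SigmaI[of UNIV "\<lambda>y. {w. (y, w) \<in> R}"] card_SigmaI[of UNIV "\<lambda>y. {w. (w, y) \<in> R}"]
    by (simp_all add: k k')
  then have "CARD('n) * k = CARD('n) * k'"
    by simp
  then have kk: "k' = k"
    by simp
  have "CARD('n) = card ({undefined} \<union> {w. (undefined, w) \<in> R} \<union> {w. (w, undefined :: 'n) \<in> R})"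
    using total by (intro arg_cong[of _ _ card]) auto
  also have "\<dots> = 1 + k + k'"
    using irrefl asym by (subst card_Un_disjoint; (subst card_Un_disjoint)?) (auto simp: k k')
  finally have k_eq: "k = 2 * u + 1"
    using n kk by simp
  obtain l where "\<forall>(y, z)\<in>R. card {w. (y, w) \<in> R \<and> (w, z) \<in> R\<inverse>} = l"
    using p[OF R(1) R' R(1)] by blast
  then have l_R: "card {w. (y, w) \<in> R \<and> (z, w) \<in> R} = l" if "(y, z) \<in> R" for y z
    using that by fastforce
  \<comment> \<open>The number of common out-neighbours is symmetric in \<open>y\<close> and
    \<open>z\<close>, so the constant for arcs serves for all distinct pairs.\<close>
  have l: "card {w. (y, w) \<in> R \<and> (z, w) \<in> R} = l" if "y \<noteq> z" for y z
    using total[OF that] l_R[of y z] l_R[of z y] by (auto simp: conj_commute)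
  define y :: 'n where "y = undefined"
  \<comment> \<open>Pairs \<open>(z, w)\<close> with arcs from \<open>y\<close> and \<open>z\<close>
    to \<open>w\<close> are counted twice: by \<open>w\<close> there are \<open>k * k\<close>, by
    \<open>z\<close> there are \<open>k\<close> plus \<open>l\<close> for each of the
    \<open>2 * k\<close> other points. This gives \<open>k = 1 + 2 * l\<close>.\<close>
  have "(\<Sum>z\<in>UNIV. card {w. (y, w) \<in> R \<and> (z, w) \<in> R})
      = (\<Sum>z\<in>UNIV. \<Sum>w\<in>UNIV. of_bool ((y, w) \<in> R \<and> (z, w) \<in> R))"
    by simp
  also have "\<dots> = (\<Sum>w\<in>UNIV. \<Sum>z\<in>UNIV. of_bool ((y, w) \<in> R \<and> (z, w) \<in> R))"
    by (rule sum.swap)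
  also have "\<dots> = (\<Sum>w\<in>UNIV. of_bool ((y, w) \<in> R) * card {z. (z, w) \<in> R})"
    by (intro sum.cong) auto
  also have "\<dots> = k * k"
    by (simp add: k k' kk flip: sum_distrib_right)
  finally have "k * k = (\<Sum>z\<in>UNIV. card {w. (y, w) \<in> R \<and> (z, w) \<in> R})" ..
  also have "\<dots> = card {w. (y, w) \<in> R \<and> (y, w) \<in> R} + (\<Sum>z\<in>UNIV-{y}. card {w. (y, w) \<in> R \<and> (z, w) \<in> R})"
    by (rule sum.remove) auto
  also have "(\<Sum>z\<in>UNIV-{y}. card {w. (y, w) \<in> R \<and> (z, w) \<in> R}) = (\<Sum>z\<in>UNIV-{y}. l)"
    by (intro sum.cong refl l) auto
  also have "\<dots> = (4 * u + 2) * l"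
    using n by simp
  finally have "k * k = k + (2 * k) * l"
    by (simp add: k k_eq)
  then have "k * k = k * (1 + 2 * l)"
    by (simp add: algebra_simps)
  moreover have "k \<noteq> 0"
    using k_eq by simp
  ultimately have "k = 1 + 2 * l"
    unfolding mult_cancel1 by blast
  then have "l = u"
    using k_eq by simp
  then show "doubly_regular_tournament R u"
    using irrefl asym total n k k' kk k_eq l by unfold_locales auto
qed

context doubly_regular_tournament
begin

lemma tournament_units_exists: "\<exists>\<Lambda> P. tournament_units R x u \<Lambda> P"
proof -
  obtain \<Lambda> P where "corner_units F1 F2 A u \<alpha> \<beta> \<Lambda> P U"
    and "\<And>T l. matrix_subalgebra T \<Longrightarrow> b \<in> T \<Longrightarrow> P l \<in> T"
    using corner_units_exists by blast
  then have "tournament_units R x u \<Lambda> P"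
    by (simp add: tournament_units_def tournament_units_axioms_def doubly_regular_tournament_axioms)
  then show ?thesis
    by blast
qed

end

theorem theorem4p3:
  fixes S :: "('n::finite \<times> 'n) set set" and R :: "('n \<times> 'n) set" and x :: 'n and u :: nat
    and idx :: "'m::finite \<Rightarrow> 'n" and B\<^sub>1 :: "complex^'m^'m"
    and smul :: "complex \<Rightarrow> 'v::ab_group_add \<Rightarrow> 'v"
  assumes "association_scheme S" and "card S = 3"
    and "R \<in> S" and "R\<inverse> \<noteq> R"
    and "CARD('n) = 4 * u + 3"
    and "is_local_block R x idx B\<^sub>1"
    and "vector_space smul"
  defines "T \<equiv> terwilliger_algebra S x"
  defines "\<alpha> \<equiv> (- 1 + csqrt (- of_nat CARD('n))) / 2"
  defines "d\<^sub>\<alpha> \<equiv> vec.dim (eigenspace B\<^sub>1 \<alpha>)"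
  defines "m\<^sub>2 \<equiv> card (iso_classes_dim T 2)"
  defines "\<epsilon> \<equiv> (if \<exists>(W :: (complex^'n) set) act. irreducible_module T (*s) W act \<and> vec.dim W = 1
              then 1 else 0 :: nat)"
  shows "(\<forall>W act. irreducible_module T smul W act \<and>
                  \<not> modules_isomorphic T smul W act (*s) (primary_module T) (*v)
            \<longrightarrow> vector_space.dim smul W = 1 \<or> vector_space.dim smul W = 2)
       \<and> (finite (iso_classes_dim T 1) \<and>
          (card (iso_classes_dim T 1) = 0 \<or> card (iso_classes_dim T 1) = 4) \<and>
          (card (iso_classes_dim T 1) = 4 \<longleftrightarrow> is_eigenvalue B\<^sub>1 \<alpha>))
       \<and> (finite (iso_classes_dim T 2) \<and>
          int m\<^sub>2 \<le> 2 * (int u - int d\<^sub>\<alpha>) \<and>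
          vector_space.dim mscale T = 9 + 4 * \<epsilon> + 4 * m\<^sub>2)"
proof -
  note S = scheme_tournament[OF assms(1-5)]
  obtain \<Lambda> P where "tournament_units R x u \<Lambda> P"
    using doubly_regular_tournament.tournament_units_exists[OF S(2)] by blast
  then interpret D: tournament_units R x u \<Lambda> P .
  have T: "T = D.units.alg"
    unfolding T_def S(1) by (rule D.terwilliger_eq)
  have \<alpha>: "D.\<alpha> = \<alpha>"
    by (simp add: D.\<alpha>_def \<alpha>_def)
  have c1: "finite (iso_classes_dim T 1)" "card (iso_classes_dim T 1) = (if P \<alpha> = 0 then 0 else 4)"
    unfolding T using D.units.iso_classes_dim_card[of 1] D.card_blocks_1 by (simp_all add: \<alpha>)
  have c2: "finite (iso_classes_dim T 2)" "m\<^sub>2 = card D.\<Lambda>2"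
    unfolding m\<^sub>2_def T using D.units.iso_classes_dim_card[of 2] D.card_blocks_2 by simp_all
  \<comment> \<open>A quotient set is empty exactly when the underlying set is, so \<epsilon> is
    governed by the number of classes, which is 0 or 4.\<close>
  have "\<epsilon> = 0 \<longleftrightarrow> irreducible_modules_dim T 1 = {}"
    unfolding \<epsilon>_def irreducible_modules_dim_def set_eq_iff by auto
  also have "\<dots> \<longleftrightarrow> iso_classes_dim T 1 = {}"
    unfolding iso_classes_dim_def quotient_is_empty ..
  also have "\<dots> \<longleftrightarrow> P \<alpha> = 0"
    using c1 by (auto simp flip: card_0_eq)
  finally have \<epsilon>: "\<epsilon> = (if P \<alpha> = 0 then 0 else 1)"
    by (auto simp: \<epsilon>_def split: if_splits)
  have "int m\<^sub>2 \<le> 2 * (int u - int d\<^sub>\<alpha>)"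
    using D.card_\<Lambda>2 D.dim_eigenspace[OF assms(6)] by (simp add: c2 d\<^sub>\<alpha>_def \<alpha>)
  moreover have "mat_vs.dim T = 9 + 4 * \<epsilon> + 4 * m\<^sub>2"
    using D.dim_alg by (simp add: T \<epsilon> c2 \<alpha>)
  moreover have "card (iso_classes_dim T 1) = 4 \<longleftrightarrow> is_eigenvalue B\<^sub>1 \<alpha>"
    using D.is_eigenvalue_iff[OF assms(6)] by (simp add: c1 \<alpha>)
  ultimately show ?thesis
    using D.dim_irreducible[OF assms(7)] c1 c2(1) by (auto simp: T)
qed

end
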